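(* $\mathsf{NULLABILITY}(\mathsf{T}{:}\,\mathcal{ELI}_\bot,\mathsf{C}{:}\,\mathcal{AQ},\mathsf{Q}{:}\,\mathcal{IQ})$ is undecidable. Moreover, $\mathsf{NULLABILITY}(\mathsf{T}{:}\,\mathcal{ELI}_\bot,\mathsf{C}{:}\,\mathcal{AQ},\mathsf{Q}{:}\,\mathcal{CQ})$ is undecidable even when the query is restricted to Boolean conjunctive queries of the form $\exists x.A(x)$ with $A$ a concept name.
   Context: Framework. An instance is a set of atoms $r(c_1,\dots,c_n)$ over constants; models may be infinite, while the database instances quantified over in the nullability problem are finite. An instance is over a signature $\Sigma$ if it uses only symbols in $\Sigma$; $\mathrm{adom}(\mathcal I)$ is its set of constants. $\mathrm{ans}(\mathcal I,q)$ is the set of answers of query $q$ in $\mathcal I$ (for a Boolean query, either $\emptyset$ or the set containing the empty tuple). For an ontology $\varphi$, instance $\mathcal I$, set $Q$ of queries, $\mathsf{CWA}(\varphi,\mathcal I,Q)$ is the set of all instances $\mathcal J$ with $\mathcal I\subseteq\mathcal J$, $\mathcal J$ a model of $\varphi$, and $\mathrm{ans}(\mathcal J,q)=\mathrm{ans}(\mathcal I,q)$ for all $q\in Q$. $\mathsf{NULLABILITY}(\mathsf{T}{:}\,\mathcal L_{TH},\mathsf{C}{:}\,\mathcal L_C,\mathsf{Q}{:}\,\mathcal L_Q)$: input $(\varphi,\Sigma,Q_C,q)$ with $\varphi\in\mathcal L_{TH}$, $\Sigma$ a signature, $Q_C\subseteq\mathcal L_C$ finite, $q\in\mathcal L_Q$;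 question: does every instance $\mathcal I$ over $\Sigma$ with $\mathsf{CWA}(\varphi,\mathcal I,Q_C)\ne\emptyset$ admit $\mathcal J\in\mathsf{CWA}(\varphi,\mathcal I,Q_C)$ with $\mathrm{ans}(\mathcal J,q)=\emptyset$? Queries: $\mathcal{AQ}$ = atomic queries $A(x)$ or $r(x,y)$ (concept name $A$, role name $r$, all variables free); $\mathcal{IQ}$ = atomic queries $A(x)$; $\mathcal{CQ}$ = conjunctive queries over concept and role names. $\mathcal{ELI}_\bot$: concept names unary, role names binary; roles $r$ and $r^-$; an ontology is a finite set of concept inclusions $C\sqsubseteq D$ where concepts are built from concept names, $\top$, $\bot$ using $C\sqcap D$ and $\exists p.C$ ($p$ a role). Semantics in an instance $\mathcal I$: $A^{\mathcal I}=\{c\mid A(c)\in\mathcal I\}$, $r^{\mathcal I}=\{(c,d)\mid r(c,d)\in\mathcal I\}$, $(r^-)^{\mathcal I}$ converse, $\top^{\mathcal I}=\mathrm{adom}(\mathcal I)$, $\bot^{\mathcal I}=\emptyset$, $(C\sqcap D)^{\mathcal I}=C^{\mathcal I}\cap D^{\mathcal I}$, $(\exists p.C)^{\mathcal I}=\{c\mid\exists d\,(c,d)\in p^{\mathcal I},d\in C^{\mathcal I}\}$; $\mathcal I$ is a model if $C^{\mathcal I}\subseteq D^{\mathcal I}$ for every inclusion $C\sqsubseteq D$. *)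

theory Defs
  imports Main "HOL-Library.Nat_Bijection"
begin

section \<open>Computability\<close>

text \<open>Partial recursive functions. The recursion argument of \<open>PRec\<close> and the search argument of
  \<open>Mu\<close> come first in the argument list.\<close>

datatype recf =
    Zero
  | Succ
  | Proj nat
  | Comp recf "recf list"
  | PRec recf recf
  | Mu recf

inductive computes :: "recf \<Rightarrow> nat list \<Rightarrow> nat \<Rightarrow> bool" where
  Zero: "computes Zero xs 0"
| Succ: "computes Succ [x] (Suc x)"
| Proj: "i < length xs \<Longrightarrow> computes (Proj i) xs (xs ! i)"
| Comp: "list_all2 (\<lambda>g y. computes g xs y) gs ys \<Longrightarrow> computes f ys z \<Longrightarrow> computes (Comp f gs) xs z"
| PRec_0: "computes f xs y \<Longrightarrow> computes (PRec f g) (0 # xs) y"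
| PRec_Suc: "computes (PRec f g) (n # xs) y \<Longrightarrow> computes g (n # y # xs) z \<Longrightarrow>
    computes (PRec f g) (Suc n # xs) z"
| Mu: "computes f (n # xs) 0 \<Longrightarrow> (\<forall>m<n. \<exists>y. computes f (m # xs) (Suc y)) \<Longrightarrow>
    computes (Mu f) xs n"

inductive_cases computes_elims:
  "computes Zero xs z" "computes Succ xs z" "computes (Proj i) xs z" "computes (Comp f gs) xs z"
  "computes (PRec f g) (0 # xs) z" "computes (PRec f g) (Suc n # xs) z" "computes (Mu f) xs z"

lemma computes_deterministic: "computes f xs y \<Longrightarrow> computes f xs z \<Longrightarrow> y = z"
proof (induction f xs y arbitrary: z rule: computes.induct)
  case (Zero xs)
  then show ?case by (rule computes_elims(1)) simp
next
  case (Succ x)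
  then show ?case by (rule computes_elims(2)) simp
next
  case (Proj i xs)
  from Proj.prems show ?case by (rule computes_elims(3)) simp
next
  case (Comp xs gs ys f z z')
  from Comp.prems obtain ys' where ys': "list_all2 (\<lambda>g y. computes g xs y) gs ys'"
    and z': "computes f ys' z'" by (rule computes_elims(4))
  have "ys = ys'"
    using Comp.IH(1) ys' by (auto simp: list_all2_conv_all_nth intro!: nth_equalityI)
  with Comp.IH(2) z' show ?case by blast
next
  case (PRec_0 f xs y g)
  from PRec_0.prems have "computes f xs z" by (rule computes_elims(5))
  then show ?case by (rule PRec_0.IH)
next
  case (PRec_Suc f g n xs y z z')
  from PRec_Suc.prems obtain y' where "computes (PRec f g) (n # xs) y'"
    and "computes g (n # y' # xs) z'" by (rule computes_elims(6))
  with PRec_Suc.IH show ?case by blast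
next
  case (Mu f n xs)
  from Mu.prems have z: "computes f (z # xs) 0" "\<forall>m<z. \<exists>y. computes f (m # xs) (Suc y)"
    by (auto elim: computes_elims(7))
  show ?case
  proof (rule linorder_cases[of n z])
    assume "n < z"
    then obtain y where "computes f (n # xs) (Suc y)" using z(2) by blast
    with Mu.IH(1) show ?thesis by fastforce
  next
    assume "z < n"
    with Mu.IH(2) z(1) show ?thesis by fastforce
  qed
qed

text \<open>A decision problem consists of its admissible inputs \<open>D\<close>, an encoding of inputs as
  numbers, and the set of yes-instances \<open>P\<close>. A decision procedure has to halt with the
  correct answer on every admissible input; its behaviour on other numbers is irrelevant.\<close>

definition decidable_problem :: "('a \<Rightarrow> nat) \<Rightarrow> 'a set \<Rightarrow> ('a \<Rightarrow> bool) \<Rightarrow> bool" where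
  "decidable_problem enc D P \<longleftrightarrow>
     (\<exists>f. \<forall>x\<in>D. computes f [enc x] (if P x then 1 else 0))"

section \<open>Instances and conjunctive queries\<close>

type_synonym cname = nat
type_synonym rname = nat
type_synonym const = nat
type_synonym var = nat

datatype symbol = CSym cname | RSym rname

datatype 'a atom = CAtom cname 'a | RAtom rname 'a 'a

primrec symbol_of :: "'a atom \<Rightarrow> symbol" where
  "symbol_of (CAtom A _) = CSym A"
| "symbol_of (RAtom r _ _) = RSym r"

text \<open>Instances may be infinite.\<close>

type_synonym inst = "const atom set"

definition adom :: "inst \<Rightarrow> const set" where
  "adom I = (\<Union>a\<in>I. set_atom a)"

definition over :: "inst \<Rightarrow> symbol set \<Rightarrow> bool" where
  "over I \<Sigma> \<longleftrightarrow> symbol_of ` I \<subseteq> \<Sigma>"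

text \<open>\<open>Query xs b\<close> has the answer variables \<open>xs\<close>; the remaining variables of the body \<open>b\<close>
  are existentially quantified. It is Boolean if \<open>xs = []\<close>.\<close>

datatype query = Query "var list" "var atom list"

primrec ans :: "inst \<Rightarrow> query \<Rightarrow> const list set" where
  "ans I (Query xs b) = {map h xs | h. map_atom h ` set b \<subseteq> I}"

definition IQ :: "query set" where
  "IQ = {Query [x] [CAtom A x] | A x. True}"

definition AQ :: "query set" where
  "AQ = IQ \<union> {Query [x, y] [RAtom r x y] | r x y. x \<noteq> y}"

definition CQ :: "query set" where
  "CQ = {Query xs b | xs b. b \<noteq> [] \<and> set xs \<subseteq> (\<Union>a\<in>set b. set_atom a)}"

definition exists_concept_queries :: "query set" where
  "exists_concept_queries = {Query [] [CAtom A x] | A x. True}"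

lemma query_classes: "IQ \<subseteq> AQ" "AQ \<subseteq> CQ" "exists_concept_queries \<subseteq> CQ"
  by (auto simp: IQ_def AQ_def CQ_def exists_concept_queries_def)

section \<open>The description logic ELI with bottom\<close>

datatype role = Role rname | Inv rname

datatype concept = CName cname | Top | Bot | Conj concept concept | Ex role concept

datatype inclusion = Incl concept concept

type_synonym ontology = "inclusion set"

definition ELI_bot :: "ontology set" where
  "ELI_bot = {\<phi>. finite \<phi>}"

primrec role_ext :: "inst \<Rightarrow> role \<Rightarrow> (const \<times> const) set" where
  "role_ext I (Role r) = {(c, d). RAtom r c d \<in> I}"
| "role_ext I (Inv r) = {(c, d). RAtom r d c \<in> I}"

primrec concept_ext :: "inst \<Rightarrow> concept \<Rightarrow> const set" where
  "concept_ext I (CName A) = {c. CAtom A c \<in> I}"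
| "concept_ext I Top = adom I"
| "concept_ext I Bot = {}"
| "concept_ext I (Conj C D) = concept_ext I C \<inter> concept_ext I D"
| "concept_ext I (Ex p C) = {c. \<exists>d. (c, d) \<in> role_ext I p \<and> d \<in> concept_ext I C}"

definition model :: "inst \<Rightarrow> ontology \<Rightarrow> bool" where
  "model I \<phi> \<longleftrightarrow> (\<forall>C D. Incl C D \<in> \<phi> \<longrightarrow> concept_ext I C \<subseteq> concept_ext I D)"

section \<open>Nullability\<close>

definition CWA :: "ontology \<Rightarrow> inst \<Rightarrow> query set \<Rightarrow> inst set" where
  "CWA \<phi> I Q = {J. I \<subseteq> J \<and> model J \<phi> \<and> (\<forall>q\<in>Q. ans J q = ans I q)}"

text \<open>Inputs are presented by lists, which stand for the finite sets of their elements.\<close>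

type_synonym input = "inclusion list \<times> symbol list \<times> query list \<times> query"

definition nullability_inputs :: "ontology set \<Rightarrow> query set \<Rightarrow> query set \<Rightarrow> input set" where
  "nullability_inputs L\<^sub>T L\<^sub>C L\<^sub>Q =
     {(\<phi>, \<Sigma>, Q, q). set \<phi> \<in> L\<^sub>T \<and> set Q \<subseteq> L\<^sub>C \<and> q \<in> L\<^sub>Q}"

fun nullable :: "input \<Rightarrow> bool" where
  "nullable (\<phi>, \<Sigma>, Q, q) \<longleftrightarrow>
     (\<forall>I. finite I \<and> over I (set \<Sigma>) \<and> CWA (set \<phi>) I (set Q) \<noteq> {} \<longrightarrow>
        (\<exists>J\<in>CWA (set \<phi>) I (set Q). ans J q = {}))"

section \<open>Encoding of inputs\<close>

primrec symbol_code :: "symbol \<Rightarrow> nat" where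
  "symbol_code (CSym A) = prod_encode (0, A)"
| "symbol_code (RSym r) = prod_encode (1, r)"

primrec role_code :: "role \<Rightarrow> nat" where
  "role_code (Role r) = prod_encode (0, r)"
| "role_code (Inv r) = prod_encode (1, r)"

primrec concept_code :: "concept \<Rightarrow> nat" where
  "concept_code (CName A) = prod_encode (0, A)"
| "concept_code Top = prod_encode (1, 0)"
| "concept_code Bot = prod_encode (2, 0)"
| "concept_code (Conj C D) = prod_encode (3, prod_encode (concept_code C, concept_code D))"
| "concept_code (Ex p C) = prod_encode (4, prod_encode (role_code p, concept_code C))"

primrec inclusion_code :: "inclusion \<Rightarrow> nat" where
  "inclusion_code (Incl C D) = prod_encode (concept_code C, concept_code D)"

primrec atom_code :: "var atom \<Rightarrow> nat" where
  "atom_code (CAtom A x) = prod_encode (0, prod_encode (A, x))"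
| "atom_code (RAtom r x y) = prod_encode (1, prod_encode (r, prod_encode (x, y)))"

primrec query_code :: "query \<Rightarrow> nat" where
  "query_code (Query xs b) = prod_encode (list_encode xs, list_encode (map atom_code b))"

fun input_code :: "input \<Rightarrow> nat" where
  "input_code (\<phi>, \<Sigma>, Q, q) =
     prod_encode (list_encode (map inclusion_code \<phi>),
       prod_encode (list_encode (map symbol_code \<Sigma>),
         prod_encode (list_encode (map query_code Q), query_code q)))"

lemma inj_symbol_code: "inj symbol_code"
proof (rule injI)
  show "s = t" if "symbol_code s = symbol_code t" for s t
    using that by (cases s; cases t) auto
qed

lemma inj_role_code: "inj role_code"
proof (rule injI)
  show "p = q" if "role_code p = role_code q" for p q
    using that by (cases p; cases q) auto
qed

lemma inj_concept_code: "inj concept_code"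
proof (rule injI)
  show "C = D" if "concept_code C = concept_code D" for C D
    using that
  proof (induction C arbitrary: D)
    case (Ex p C)
    then show ?case by (cases D) (auto dest: injD[OF inj_role_code])
  next
    case (Conj C1 C2)
    then show ?case by (cases D) auto
  next
    case (CName A)
    then show ?case by (cases D) auto
  next
    case Top
    then show ?case by (cases D) auto
  next
    case Bot
    then show ?case by (cases D) auto
  qed
qed

lemma inj_inclusion_code: "inj inclusion_code"
proof (rule injI)
  show "s = t" if "inclusion_code s = inclusion_code t" for s t
    using that by (cases s; cases t) (auto dest: injD[OF inj_concept_code])
qed

lemma inj_atom_code: "inj atom_code"
proof (rule injI)
  show "a = b" if "atom_code a = atom_code b" for a b
    using that by (cases a; cases b) auto
qed

lemma inj_query_code: "inj query_code"
proof (rule injI)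
  show "p = q" if "query_code p = query_code q" for p q
    using that by (cases p; cases q) (auto simp: list_encode_eq inj_map_eq_map[OF inj_atom_code])
qed

lemma inj_input_code: "inj input_code"
proof (rule injI)
  show "i = j" if "input_code i = input_code j" for i j
    using that by (cases i; cases j)
      (auto simp: list_encode_eq inj_map_eq_map[OF inj_inclusion_code] inj_map_eq_map[OF inj_symbol_code]
        inj_map_eq_map[OF inj_query_code] dest: injD[OF inj_query_code])
qed

end

theory Submission
  imports Defs "HOL-Library.Countable"
begin

text \<open>An input is not nullable iff some consistent instance over the signature forces the query.
  For a recursive function \<open>f\<close> and a number \<open>n\<close>, the ontology is designed so that such an instance has to
  contain a derivation tree of \<open>computes f [n] y\<close> over closed roles, with numbers and argument
  lists as linked lists. The tree-shaped part of a rule application is checked by Horn inclusions,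
  which derive a label for each correct subtree. The equalities between the values at a node and
  at its children cannot be expressed by inclusions. Instead, a model may choose between
  running the Horn rules and exhibiting a violated equality by putting two marks, which together
  force the query, on the two ends of the paths. So only an instance in which all equalities hold
  can force the query. As the signature and the closed predicates do not depend on \<open>f\<close>, the input
  can be computed from the code of the inclusions for \<open>f\<close>, and the code of an ontology can be given
  to the simulated function itself; a decision procedure is then refuted by diagonalization.\<close>

section \<open>Evaluation of recursive functions by rules with path equations\<close>

text \<open>Inclusions in \<open>ELI_bot\<close> are Horn, so the ontology alone never offers a
  choice. The choice of a mode comes from closing \<open>AnyMode\<close>: the
  \<open>Pick\<close>-witness of a root has to be a constant that the instance already marks, and
  different modes are disjoint. \<open>Pick\<close> and \<open>Look\<close> are not closed.
  \<open>Look\<close> may lead from a root to any element, so a violated equality can be exhibited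
  anywhere in the instance, connected to the root or not; it cannot be invented, since the kinds and
  the roles on the paths are closed. Arbitrary instances may branch, hence functionality of the
  closed roles is itself among the equalities. Cyclic "values" are harmless: \<open>IsVal\<close>
  and \<open>Der\<close> are derived bottom-up, so a suitable model leaves elements on a cycle
  unlabelled. The input number enters through a single inclusion. Passing from the code of an
  ontology to the input that runs it on this code therefore takes only numerals and pairing, and the
  self-reference needs no universal function.\<close>

datatype val = Nul | Pr val val

primrec num :: "nat \<Rightarrow> val" where
  "num 0 = Nul"
| "num (Suc n) = Pr Nul (num n)"

primrec nums :: "nat list \<Rightarrow> val" where
  "nums [] = Nul"
| "nums (x # xs) = Pr (num x) (nums xs)"

text \<open>\<open>Search f\<close> maps \<open>m # xs\<close> to the least zero of \<open>\<lambda>n. f (n # xs)\<close> that is at least \<open>m\<close>.\<close>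

datatype prog = Fun recf | Funs "recf list" | Search recf

datatype kind = KZero | KSucc | KHead | KNext | KComp | KNil | KCons | KRec0 | KRecS
  | KMu | KStop | KCont

text \<open>Equations belong to the kind, programs only to the labels that are derived. As there are
  finitely many kinds, the closed symbols and the equalities form one fixed finite list for all
  functions.\<close>

type_synonym rule = "kind \<times> prog \<times> prog list"

datatype field = Arg | Res

datatype dir = Hd | Tl

text \<open>In \<open>At i fl ds\<close>, index \<open>0\<close> stands for the conclusion of a rule and index \<open>i + 1\<close> for its
  \<open>i\<close>-th premise.\<close>

datatype pos = At nat field "dir list"

type_synonym judgement = "val \<times> val"

primrec field_val :: "field \<Rightarrow> judgement \<Rightarrow> val" where
  "field_val Arg j = fst j"
| "field_val Res j = snd j"

fun sel :: "dir list \<Rightarrow> val \<Rightarrow> val option" where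
  "sel [] v = Some v"
| "sel (Hd # ds) (Pr u w) = sel ds u"
| "sel (Tl # ds) (Pr u w) = sel ds w"
| "sel (d # ds) Nul = None"

primrec val_at :: "judgement list \<Rightarrow> pos \<Rightarrow> val option" where
  "val_at js (At i fl ds) = sel ds (field_val fl (js ! i))"

primrec pos_index :: "pos \<Rightarrow> nat" where
  "pos_index (At i fl ds) = i"

text \<open>Rules cannot build terms, so a constructed argument of a premise is described by its
  components: under \<open>KMu\<close> the premise gets \<open>Pr Nul a\<close>, given by its tail
  here and its head in \<open>nils\<close>. On numerals \<open>Tl\<close> is the predecessor, so
  \<open>[Hd, Tl]\<close> is the predecessor of the first argument. The equation of
  \<open>KCont\<close> between a position and itself is not void: \<open>holds\<close> demands that
  the position is defined, so the first result is a pair, that is, nonzero.\<close>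

primrec eqs :: "kind \<Rightarrow> (pos \<times> pos) list" where
  "eqs KZero = []"
| "eqs KSucc = [(At 0 Res [Tl], At 0 Arg [Hd])]"
| "eqs KHead = [(At 0 Res [], At 0 Arg [Hd])]"
| "eqs KNext = [(At 1 Arg [], At 0 Arg [Tl]), (At 1 Res [], At 0 Res [])]"
| "eqs KComp = [(At 1 Arg [], At 0 Arg []), (At 2 Arg [], At 1 Res []), (At 2 Res [], At 0 Res [])]"
| "eqs KNil = []"
| "eqs KCons = [(At 1 Arg [], At 0 Arg []), (At 2 Arg [], At 0 Arg []),
     (At 1 Res [], At 0 Res [Hd]), (At 2 Res [], At 0 Res [Tl])]"
| "eqs KRec0 = [(At 1 Arg [], At 0 Arg [Tl]), (At 1 Res [], At 0 Res [])]"
| "eqs KRecS = [(At 1 Arg [Hd], At 0 Arg [Hd, Tl]), (At 1 Arg [Tl], At 0 Arg [Tl]),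
     (At 2 Arg [Hd], At 0 Arg [Hd, Tl]), (At 2 Arg [Tl, Hd], At 1 Res []),
     (At 2 Arg [Tl, Tl], At 0 Arg [Tl]), (At 2 Res [], At 0 Res [])]"
| "eqs KMu = [(At 1 Arg [Tl], At 0 Arg []), (At 1 Res [], At 0 Res [])]"
| "eqs KStop = [(At 1 Arg [], At 0 Arg []), (At 0 Res [], At 0 Arg [Hd])]"
| "eqs KCont = [(At 1 Arg [], At 0 Arg []), (At 1 Res [Tl], At 1 Res [Tl]),
     (At 2 Arg [Hd, Tl], At 0 Arg [Hd]), (At 2 Arg [Tl], At 0 Arg [Tl]), (At 2 Res [], At 0 Res [])]"

primrec nils :: "kind \<Rightarrow> pos list" where
  "nils KZero = [At 0 Res []]"
| "nils KSucc = [At 0 Res [Hd], At 0 Arg [Tl]]"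
| "nils KHead = []"
| "nils KNext = []"
| "nils KComp = []"
| "nils KNil = [At 0 Res []]"
| "nils KCons = []"
| "nils KRec0 = [At 0 Arg [Hd]]"
| "nils KRecS = []"
| "nils KMu = [At 1 Arg [Hd]]"
| "nils KStop = [At 1 Res []]"
| "nils KCont = [At 2 Arg [Hd, Hd]]"

definition holds :: "kind \<Rightarrow> judgement list \<Rightarrow> bool" where
  "holds k js \<longleftrightarrow>
     (\<forall>(s, t)\<in>set (eqs k). val_at js s \<noteq> None \<and> val_at js s = val_at js t) \<and>
     (\<forall>s\<in>set (nils k). val_at js s = Some Nul)"

inductive ev :: "rule set \<Rightarrow> prog \<Rightarrow> val \<Rightarrow> val \<Rightarrow> bool" for R where
  ev: "(k, p, ps) \<in> R \<Longrightarrow> list_all2 (\<lambda>q (a, r). ev R q a r) ps js \<Longrightarrow> holds k ((a, r) # js) \<Longrightarrow>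
    ev R p a r"

text \<open>The infinite system for all functions at once. Soundness is shown for it and passes to
  each finite \<open>rules_of f\<close> by monotonicity.\<close>

inductive_set recf_rules :: "rule set" where
  "(KZero, Fun Zero, []) \<in> recf_rules"
| "(KSucc, Fun Succ, []) \<in> recf_rules"
| "(KHead, Fun (Proj 0), []) \<in> recf_rules"
| "(KNext, Fun (Proj (Suc i)), [Fun (Proj i)]) \<in> recf_rules"
| "(KComp, Fun (Comp f gs), [Funs gs, Fun f]) \<in> recf_rules"
| "(KNil, Funs [], []) \<in> recf_rules"
| "(KCons, Funs (g # gs), [Fun g, Funs gs]) \<in> recf_rules"
| "(KRec0, Fun (PRec f g), [Fun f]) \<in> recf_rules"
| "(KRecS, Fun (PRec f g), [Fun (PRec f g), Fun g]) \<in> recf_rules"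
| "(KMu, Fun (Mu f), [Search f]) \<in> recf_rules"
| "(KStop, Search f, [Fun f]) \<in> recf_rules"
| "(KCont, Search f, [Fun f, Search f]) \<in> recf_rules"

text \<open>An ontology is finite, so only the rules reachable from \<open>f\<close> are collected:
  for a projection those of all smaller indices, for a composition those of all suffixes of the list
  of inner functions.\<close>

fun rules_of :: "recf \<Rightarrow> rule list" where
  "rules_of Zero = [(KZero, Fun Zero, [])]"
| "rules_of Succ = [(KSucc, Fun Succ, [])]"
| "rules_of (Proj i) = (KHead, Fun (Proj 0), []) #
     map (\<lambda>j. (KNext, Fun (Proj (Suc j)), [Fun (Proj j)])) [0..<i]"
| "rules_of (Comp f gs) = (KComp, Fun (Comp f gs), [Funs gs, Fun f]) # (KNil, Funs [], []) #
     map (\<lambda>j. (KCons, Funs (drop j gs), [Fun (gs ! j), Funs (drop (Suc j) gs)])) [0..<length gs] @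
     rules_of f @ concat (map rules_of gs)"
| "rules_of (PRec f g) = (KRec0, Fun (PRec f g), [Fun f]) #
     (KRecS, Fun (PRec f g), [Fun (PRec f g), Fun g]) # rules_of f @ rules_of g"
| "rules_of (Mu f) = (KMu, Fun (Mu f), [Search f]) # (KStop, Search f, [Fun f]) #
     (KCont, Search f, [Fun f, Search f]) # rules_of f"

section \<open>Agreement of the rule systems with \<open>computes\<close>\<close>

lemma rules_of_subset: "set (rules_of f) \<subseteq> recf_rules"
  by (induction f rule: rules_of.induct)
    (auto simp: Cons_nth_drop_Suc[symmetric] simp del: drop_Suc intro: recf_rules.intros)

text \<open>Positions must refer to existing premises, since \<open>val_at\<close> looks judgements
  up with \<open>!\<close>. The bound two matches the roles \<open>Premise 0\<close> and
  \<open>Premise 1\<close> among the closed roles.\<close>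

lemma recf_rules_wf:
  assumes "(k, p, ps) \<in> recf_rules"
  shows "length ps \<le> 2"
    and "(s, t) \<in> set (eqs k) \<Longrightarrow> pos_index s \<le> length ps \<and> pos_index t \<le> length ps"
    and "s \<in> set (nils k) \<Longrightarrow> pos_index s \<le> length ps"
  using assms by (auto elim!: recf_rules.cases)

lemma ev_mono: "ev R p a r \<Longrightarrow> R \<subseteq> R' \<Longrightarrow> ev R' p a r"
proof (induction rule: ev.induct)
  case (ev k p ps js a r)
  then show ?case
    by (intro ev.ev[of k p ps R' js]) (auto elim!: list_all2_mono)
qed

lemma num_eq_Nul [simp]: "num n = Nul \<longleftrightarrow> n = 0" "Nul = num n \<longleftrightarrow> n = 0"
  by (cases n; simp)+

lemma sel_eq_Some [simp]:
  "sel (Hd # ds) v = Some w \<longleftrightarrow> (\<exists>u t. v = Pr u t \<and> sel ds u = Some w)"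
  "sel (Tl # ds) v = Some w \<longleftrightarrow> (\<exists>u t. v = Pr u t \<and> sel ds t = Some w)"
  by (cases v; simp)+

lemma num_eq_Pr:
  "num n = Pr u w \<longleftrightarrow> u = Nul \<and> (\<exists>m. n = Suc m \<and> w = num m)"
  "Pr u w = num n \<longleftrightarrow> u = Nul \<and> (\<exists>m. n = Suc m \<and> w = num m)"
  by (cases n; auto)+

lemma nums_eq_Pr:
  "nums xs = Pr u w \<longleftrightarrow> (\<exists>y ys. xs = y # ys \<and> u = num y \<and> w = nums ys)"
  "Pr u w = nums xs \<longleftrightarrow> (\<exists>y ys. xs = y # ys \<and> u = num y \<and> w = nums ys)"
  by (cases xs; auto)+

lemma nums_eq_Nul [simp]: "nums xs = Nul \<longleftrightarrow> xs = []" "Nul = nums xs \<longleftrightarrow> xs = []"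
  by (cases xs; simp)+

lemma num_eq_iff [simp]: "num m = num n \<longleftrightarrow> m = n"
proof (induction m arbitrary: n)
  case (Suc m)
  then show ?case by (cases n) auto
qed simp

lemma nums_eq_iff [simp]: "nums xs = nums ys \<longleftrightarrow> xs = ys"
proof (induction xs arbitrary: ys)
  case (Cons x xs)
  then show ?case by (cases ys) auto
qed auto

lemma holds_iff:
  "holds k js \<longleftrightarrow>
     (\<forall>(s, t)\<in>set (eqs k). \<exists>v. val_at js s = Some v \<and> val_at js t = Some v) \<and>
     (\<forall>s\<in>set (nils k). val_at js s = Some Nul)"
  unfolding holds_def by (intro conj_cong ball_cong) auto

text \<open>The rules do not check that values encode numbers (\<open>KHead\<close> returns any head
  whatsoever). The claims are therefore conditional on a well-formed argument, and well-formedness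
  of the result is part of what the induction carries.\<close>

lemma ev_computes:
  assumes "ev recf_rules p a r"
  shows "case p of
      Fun f \<Rightarrow> \<forall>xs. a = nums xs \<longrightarrow> (\<exists>y. r = num y \<and> computes f xs y)
    | Funs gs \<Rightarrow> \<forall>xs. a = nums xs \<longrightarrow> (\<exists>ys. r = nums ys \<and> list_all2 (\<lambda>g y. computes g xs y) gs ys)
    | Search f \<Rightarrow> \<forall>m xs. a = nums (m # xs) \<longrightarrow> (\<exists>n\<ge>m. r = num n \<and> computes f (n # xs) 0 \<and>
        (\<forall>j. m \<le> j \<and> j < n \<longrightarrow> (\<exists>y. computes f (j # xs) (Suc y))))"
  using assms
proof (induction rule: ev.induct)
  case (ev k p ps js a r)
  note H = ev(2,3)[unfolded holds_iff]
  from ev(1) show ?case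
  proof cases
    case 1
    with H show ?thesis by (auto simp: computes.Zero)
  next
    case 2
    with H obtain x where a: "a = Pr x Nul" and r: "r = Pr Nul x"
      by (auto simp: list_all2_Cons1)
    have "\<exists>y. r = num y \<and> computes Succ xs y" if xs: "a = nums xs" for xs
    proof -
      obtain n where "xs = [n]" "x = num n" using xs a by (auto simp: nums_eq_Pr)
      then show ?thesis using r by (intro exI[of _ "Suc n"]) (auto intro: computes.Succ)
    qed
    with 2 show ?thesis by simp
  next
    case 3
    with H obtain w where a: "a = Pr r w" by (auto simp: list_all2_Cons1)
    have "\<exists>y. r = num y \<and> computes (Proj 0) xs y" if xs: "a = nums xs" for xs
    proof -
      obtain n ns where "xs = n # ns" "r = num n" using xs a by (auto simp: nums_eq_Pr)
      then show ?thesis using computes.Proj[of 0 "n # ns"] by auto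
    qed
    with 3 show ?thesis by simp
  next
    case (4 i)
    with H obtain u w where a: "a = Pr u w"
      and IH: "\<forall>xs. w = nums xs \<longrightarrow> (\<exists>y. r = num y \<and> computes (Proj i) xs y)"
      by (auto simp: list_all2_Cons1)
    have "\<exists>y. r = num y \<and> computes (Proj (Suc i)) xs y" if xs: "a = nums xs" for xs
    proof -
      obtain n ns where ns: "xs = n # ns" "w = nums ns" using xs a by (auto simp: nums_eq_Pr)
      then obtain y where "r = num y" "computes (Proj i) ns y" using IH by blast
      then show ?thesis
        using computes.Proj[of "Suc i" "n # ns"] ns by (auto elim!: computes_elims(3))
    qed
    with 4 show ?thesis by simp
  next
    case (5 f gs)
    with H obtain w where
          IH1: "\<forall>xs. a = nums xs \<longrightarrow> (\<exists>ys. w = nums ys \<and> list_all2 (\<lambda>g y. computes g xs y) gs ys)"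
      and IH2: "\<forall>xs. w = nums xs \<longrightarrow> (\<exists>y. r = num y \<and> computes f xs y)"
      by (auto simp: list_all2_Cons1)
    have "\<exists>y. r = num y \<and> computes (Comp f gs) xs y" if xs: "a = nums xs" for xs
    proof -
      obtain ys where ys: "w = nums ys" "list_all2 (\<lambda>g y. computes g xs y) gs ys"
        using IH1 xs by blast
      then obtain y where "r = num y" "computes f ys y" using IH2 by blast
      with ys(2) show ?thesis by (blast intro: computes.Comp)
    qed
    with 5 show ?thesis by simp
  next
    case 6
    with H show ?thesis by auto
  next
    case (7 g gs)
    with H obtain u w where r: "r = Pr u w"
      and IH1: "\<forall>xs. a = nums xs \<longrightarrow> (\<exists>y. u = num y \<and> computes g xs y)"
      and IH2: "\<forall>xs. a = nums xs \<longrightarrow> (\<exists>ys. w = nums ys \<and> list_all2 (\<lambda>g y. computes g xs y) gs ys)"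
      by (auto simp: list_all2_Cons1)
    have "\<exists>ys. r = nums ys \<and> list_all2 (\<lambda>g y. computes g xs y) (g # gs) ys" if xs: "a = nums xs" for xs
    proof -
      obtain y ys where "u = num y" "computes g xs y" "w = nums ys"
        "list_all2 (\<lambda>g y. computes g xs y) gs ys" using IH1 IH2 xs by blast
      then show ?thesis using r by (intro exI[of _ "y # ys"]) simp
    qed
    with 7 show ?thesis by simp
  next
    case (8 f g)
    with H obtain w where a: "a = Pr Nul w"
      and IH: "\<forall>xs. w = nums xs \<longrightarrow> (\<exists>y. r = num y \<and> computes f xs y)"
      by (auto simp: list_all2_Cons1)
    have "\<exists>y. r = num y \<and> computes (PRec f g) xs y" if xs: "a = nums xs" for xs
    proof -
      obtain ys where ys: "xs = 0 # ys" "w = nums ys" using xs a by (auto simp: nums_eq_Pr)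
      then show ?thesis using IH by (blast intro: computes.PRec_0)
    qed
    with 8 show ?thesis by simp
  next
    case (9 f g)
    with H obtain n u w a2 r1 where a: "a = Pr (Pr u n) w"
      and IH1: "\<forall>xs. Pr n w = nums xs \<longrightarrow> (\<exists>y. r1 = num y \<and> computes (PRec f g) xs y)"
      and IH2: "\<forall>xs. Pr n (Pr r1 w) = nums xs \<longrightarrow> (\<exists>y. r = num y \<and> computes g xs y)"
      by (auto simp: list_all2_Cons1)
    \<comment> \<open>The rule leaves \<open>u\<close> unconstrained; it is \<open>Nul\<close>
      because the first argument is a numeral.\<close>
    have "\<exists>y. r = num y \<and> computes (PRec f g) xs y" if xs: "a = nums xs" for xs
    proof -
      obtain m ys where "xs = Suc m # ys" and nw: "n = num m" "w = nums ys"
        using xs a by (auto simp: nums_eq_Pr num_eq_Pr)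
      moreover obtain y where "r1 = num y" "computes (PRec f g) (m # ys) y"
        using IH1 nw by (metis nums.simps(2))
      moreover obtain z where "r = num z" "computes g (m # y # ys) z"
        using IH2 nw \<open>r1 = num y\<close> by (metis nums.simps(2))
      ultimately show ?thesis by (blast intro: computes.PRec_Suc)
    qed
    with 9 show ?thesis by simp
  next
    case (10 f)
    with H have IH: "\<forall>m xs. Pr Nul a = nums (m # xs) \<longrightarrow> (\<exists>n\<ge>m. r = num n \<and> computes f (n # xs) 0 \<and>
        (\<forall>j. m \<le> j \<and> j < n \<longrightarrow> (\<exists>y. computes f (j # xs) (Suc y))))"
      by (auto simp: list_all2_Cons1)
    have "\<exists>y. r = num y \<and> computes (Mu f) xs y" if xs: "a = nums xs" for xs
      using IH[rule_format, of 0 xs] xs by (auto intro: computes.Mu)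
    with 10 show ?thesis by simp
  next
    case (11 f)
    with H obtain w where a: "a = Pr r w"
      and IH: "\<forall>xs. a = nums xs \<longrightarrow> (\<exists>y. Nul = num y \<and> computes f xs y)"
      by (auto simp: list_all2_Cons1)
    have "\<exists>n\<ge>m. r = num n \<and> computes f (n # xs) 0 \<and>
        (\<forall>j. m \<le> j \<and> j < n \<longrightarrow> (\<exists>y. computes f (j # xs) (Suc y)))" if "a = nums (m # xs)" for m xs
      using IH that a by (intro exI[of _ m]) auto
    with 11 show ?thesis by simp
  next
    case (12 f)
    with H obtain n w r1 u1 u2 where a: "a = Pr n w"
      and IH1: "\<forall>xs. a = nums xs \<longrightarrow> (\<exists>y. Pr u1 u2 = num y \<and> computes f xs y)"
      and IH2: "\<forall>m xs. Pr (Pr Nul n) w = nums (m # xs) \<longrightarrow> (\<exists>n\<ge>m. r = num n \<and> computes f (n # xs) 0 \<and>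
        (\<forall>j. m \<le> j \<and> j < n \<longrightarrow> (\<exists>y. computes f (j # xs) (Suc y))))"
      by (auto simp: list_all2_Cons1)
    have "\<exists>n\<ge>m. r = num n \<and> computes f (n # xs) 0 \<and>
        (\<forall>j. m \<le> j \<and> j < n \<longrightarrow> (\<exists>y. computes f (j # xs) (Suc y)))" if xs: "a = nums (m # xs)" for m xs
    proof -
      \<comment> \<open>A numeral that is a pair is a successor; that the result is a pair is the
        effect of the reflexive equation of \<open>KCont\<close>.\<close>
      obtain y where y: "computes f (m # xs) (Suc y)"
        using IH1 xs num_eq_Pr(2)[of u1 u2] by metis
      have "Pr (Pr Nul n) w = nums (Suc m # xs)" using a xs by simp
      with IH2 obtain z where z: "z \<ge> Suc m" "r = num z" "computes f (z # xs) 0"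
        "\<forall>j. Suc m \<le> j \<and> j < z \<longrightarrow> (\<exists>y. computes f (j # xs) (Suc y))" by blast
      have "\<exists>y. computes f (j # xs) (Suc y)" if "m \<le> j" "j < z" for j
        using y z(4) that by (cases "j = m") auto
      with z show ?thesis by (auto intro!: exI[of _ z])
    qed
    with 12 show ?thesis by simp
  qed
qed

lemma ev_Proj:
  assumes "i < length xs" "set (rules_of (Proj i)) \<subseteq> R"
  shows "ev R (Fun (Proj i)) (nums xs) (num (xs ! i))"
  using assms
proof (induction i arbitrary: xs)
  case 0
  then obtain x ys where "xs = x # ys" by (cases xs) auto
  with 0 show ?case by (intro ev.ev[of KHead _ "[]" R "[]"]) (auto simp: holds_iff)
next
  case (Suc i)
  then obtain x ys where xs: "xs = x # ys" by (cases xs) auto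
  have "ev R (Fun (Proj i)) (nums ys) (num (ys ! i))"
    using Suc.prems by (intro Suc.IH) (auto simp: xs)
  with Suc.prems xs show ?case
    by (intro ev.ev[of KNext _ "[Fun (Proj i)]" R "[(nums ys, num (ys ! i))]"]) (auto simp: holds_iff)
qed

lemma ev_Funs:
  assumes "list_all2 (\<lambda>g y. ev R (Fun g) (nums xs) (num y)) gs ys"
    and "(KNil, Funs [], []) \<in> R"
    and "\<And>j. j < length gs \<Longrightarrow> (KCons, Funs (drop j gs), [Fun (gs ! j), Funs (drop (Suc j) gs)]) \<in> R"
  shows "ev R (Funs gs) (nums xs) (nums ys)"
  using assms
proof (induction rule: list_all2_induct)
  case Nil
  then show ?case by (intro ev.ev[of KNil _ "[]" R "[]"]) (auto simp: holds_iff)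
next
  case (Cons g gs y ys)
  have "ev R (Funs gs) (nums xs) (nums ys)"
    \<comment> \<open>Suffix \<open>j\<close> of \<open>gs\<close> is suffix \<open>j + 1\<close> of
      \<open>g # gs\<close>.\<close>
    using Cons.prems(2)[of "Suc _"] by (intro Cons.IH Cons.prems(1)) auto
  with Cons.hyps Cons.prems(2)[of 0] show ?case
    by (intro ev.ev[of KCons _ "[Fun g, Funs gs]" R "[(nums xs, num y), (nums xs, nums ys)]"])
      (auto simp: holds_iff)
qed

text \<open>Induction downwards from the zero \<open>n\<close>, where \<open>KStop\<close> applies;
  every smaller starting point adds one use of \<open>KCont\<close>.\<close>

lemma ev_Search:
  assumes "m \<le> n" "ev R (Fun f) (nums (n # xs)) Nul"
    and "\<And>j. j < n \<Longrightarrow> \<exists>y. ev R (Fun f) (nums (j # xs)) (num (Suc y))"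
    and "(KStop, Search f, [Fun f]) \<in> R" "(KCont, Search f, [Fun f, Search f]) \<in> R"
  shows "ev R (Search f) (nums (m # xs)) (num n)"
  using assms(1)
proof (induction rule: inc_induct)
  case base
  from assms show ?case
    by (intro ev.ev[of KStop _ "[Fun f]" R "[(nums (n # xs), Nul)]"]) (auto simp: holds_iff)
next
  case (step m)
  obtain y where "ev R (Fun f) (nums (m # xs)) (num (Suc y))" using assms(3) step by blast
  with step assms show ?case
    by (intro ev.ev[of KCont _ "[Fun f, Search f]" R
        "[(nums (m # xs), num (Suc y)), (nums (Suc m # xs), num n)]"]) (auto simp: holds_iff)
qed

lemma computes_ev:
  assumes "computes f xs y" "set (rules_of f) \<subseteq> R"
  shows "ev R (Fun f) (nums xs) (num y)"
  using assms
proof (induction rule: computes.induct)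
  case (Zero xs)
  then show ?case by (intro ev.ev[of KZero _ "[]" R "[]"]) (auto simp: holds_iff)
next
  case (Succ x)
  then show ?case by (intro ev.ev[of KSucc _ "[]" R "[]"]) (auto simp: holds_iff)
next
  case (Proj i xs)
  then show ?case by (rule ev_Proj)
next
  case (Comp xs gs ys f z)
  have "ev R (Funs gs) (nums xs) (nums ys)"
    using Comp.prems Comp.IH(1)
    by (intro ev_Funs) (auto simp: list_all2_conv_all_nth UN_subset_iff)
  moreover have "ev R (Fun f) (nums ys) (num z)" using Comp by auto
  ultimately show ?case using Comp.prems
    by (intro ev.ev[of KComp _ "[Funs gs, Fun f]" R "[(nums xs, nums ys), (nums ys, num z)]"])
      (auto simp: holds_iff)
next
  case (PRec_0 f xs y g)
  then show ?case
    by (intro ev.ev[of KRec0 _ "[Fun f]" R "[(nums xs, num y)]"]) (auto simp: holds_iff)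
next
  case (PRec_Suc f g n xs y z)
  then show ?case
    by (intro ev.ev[of KRecS _ "[Fun (PRec f g), Fun g]" R
        "[(nums (n # xs), num y), (nums (n # y # xs), num z)]"]) (auto simp: holds_iff)
next
  case (Mu f n xs)
  have "ev R (Search f) (nums (0 # xs)) (num n)"
    using Mu by (intro ev_Search) auto
  with Mu.prems show ?case
    by (intro ev.ev[of KMu _ "[Search f]" R "[(nums (0 # xs), num n)]"]) (auto simp: holds_iff)
qed

section \<open>The ontology of a system of rules\<close>

text \<open>Symbols and constants are natural numbers, so structured names are numbered by the
  injection \<open>to_nat\<close>. Its values enter the later computations only as constants, so it
  does not matter how it is computed.\<close>

instance recf :: countable by countable_datatype
instance prog :: countable by countable_datatype
instance kind :: countable by countable_datatype
instance field :: countable by countable_datatype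
instance dir :: countable by countable_datatype
instance val :: countable by countable_datatype

datatype csym = Kind kind | IsNil | Root | AnyMode | Mode nat
  | Goal | LeftEnd | RightEnd | IsInput | IsVal | Der prog

datatype rsym = Fld field | Dir dir | Premise nat | Pick | Look

instance csym :: countable by countable_datatype
instance rsym :: countable by countable_datatype

abbreviation concept_name :: "csym \<Rightarrow> concept" ("\<langle>_\<rangle>") where
  "\<langle>A\<rangle> \<equiv> CName (to_nat A)"

abbreviation catom :: "csym \<Rightarrow> 'a \<Rightarrow> 'a atom" where
  "catom A x \<equiv> CAtom (to_nat A) x"

abbreviation ratom :: "rsym \<Rightarrow> 'a \<Rightarrow> 'a \<Rightarrow> 'a atom" where
  "ratom e x y \<equiv> RAtom (to_nat e) x y"

primrec along :: "rsym list \<Rightarrow> concept \<Rightarrow> concept" where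
  "along [] C = C"
| "along (e # es) C = Ex (Role (to_nat e)) (along es C)"

primrec conjs :: "concept list \<Rightarrow> concept" where
  "conjs [] = Top"
| "conjs (C # Cs) = Conj C (conjs Cs)"

primrec pos_path :: "pos \<Rightarrow> rsym list" where
  "pos_path (At i fl ds) = (case i of 0 \<Rightarrow> [] | Suc j \<Rightarrow> [Premise j]) @ Fld fl # map Dir ds"

definition closed_roles :: "rsym list" where
  "closed_roles = [Fld Arg, Fld Res, Dir Hd, Dir Tl, Premise 0, Premise 1]"

definition kinds :: "kind list" where
  "kinds = [KZero, KSucc, KHead, KNext, KComp, KNil, KCons, KRec0, KRecS, KMu, KStop, KCont]"

text \<open>A triple \<open>(C, es, es')\<close> demands that at every element of \<open>C\<close> all ends of \<open>es\<close>-paths and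
  \<open>es'\<close>-paths coincide.\<close>

definition egds :: "(concept \<times> rsym list \<times> rsym list) list" where
  "egds = map (\<lambda>e. (Top, [e], [e])) closed_roles @
     concat (map (\<lambda>k. map (\<lambda>(s, t). (\<langle>Kind k\<rangle>, pos_path s, pos_path t)) (eqs k)) kinds)"

abbreviation modes :: "nat list" where
  "modes \<equiv> [0..<Suc (length egds)]"

definition closed_concepts :: "csym list" where
  "closed_concepts = map Kind kinds @ [IsNil, Root, AnyMode] @ map Mode modes"

text \<open>Roots pick a mode. Mode \<open>0\<close> runs the rules, and mode \<open>i + 1\<close> claims that the \<open>i\<close>-th equality
  fails: if it does, two distinct ends can be marked \<open>LeftEnd\<close> and \<open>RightEnd\<close> without forcing \<open>Goal\<close>.\<close>

definition egd_incl :: "nat \<Rightarrow> concept \<times> rsym list \<times> rsym list \<Rightarrow> inclusion" where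
  "egd_incl i = (\<lambda>(C, es, es'). Incl (along [Pick] \<langle>Mode (Suc i)\<rangle>)
     (along [Look] (conjs [C, along es \<langle>LeftEnd\<rangle>, along es' \<langle>RightEnd\<rangle>])))"

text \<open>Since modes are closed, \<open>Root\<close> below \<open>Look\<close> to
  \<open>Mode i\<close> makes the instance itself supply an element of each mode, so no choice is
  blocked. Disjointness makes the choice unambiguous. Forbidding components of \<open>IsNil\<close>
  elements makes the represented value unique, and \<open>IsVal\<close> climbs from nil upwards,
  which singles out the well-founded values.\<close>

definition base_incls :: "inclusion list" where
  "base_incls =
     map (\<lambda>i. Incl \<langle>Mode i\<rangle> \<langle>AnyMode\<rangle>) modes @
     map (\<lambda>i. Incl \<langle>Root\<rangle> (along [Look] \<langle>Mode i\<rangle>)) modes @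
     [Incl (Conj \<langle>Mode i\<rangle> \<langle>Mode j\<rangle>) Bot. i \<leftarrow> modes, j \<leftarrow> modes, i \<noteq> j] @
     map (\<lambda>i. egd_incl i (egds ! i)) [0..<length egds] @
     [Incl \<langle>Root\<rangle> (along [Pick] \<langle>AnyMode\<rangle>),
      Incl (Conj \<langle>LeftEnd\<rangle> \<langle>RightEnd\<rangle>) \<langle>Goal\<rangle>,
      Incl (Conj \<langle>IsNil\<rangle> (along [Dir Hd] Top)) Bot,
      Incl (Conj \<langle>IsNil\<rangle> (along [Dir Tl] Top)) Bot,
      Incl \<langle>IsNil\<rangle> \<langle>IsVal\<rangle>,
      Incl (Conj (along [Dir Hd] \<langle>IsVal\<rangle>) (along [Dir Tl] \<langle>IsVal\<rangle>)) \<langle>IsVal\<rangle>]"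

text \<open>For an equation only the existence of both path ends is demanded; that they coincide is
  left to the modes. The \<open>IsVal\<close> conditions ensure that argument and result represent
  values at all.\<close>

definition rule_body :: "kind \<Rightarrow> prog list \<Rightarrow> concept list" where
  "rule_body k ps =
     [\<langle>Kind k\<rangle>, along [Fld Arg] \<langle>IsVal\<rangle>, along [Fld Res] \<langle>IsVal\<rangle>] @
     map (\<lambda>i. along [Premise i] \<langle>Der (ps ! i)\<rangle>) [0..<length ps] @
     concat (map (\<lambda>(s, t). [along (pos_path s) Top, along (pos_path t) Top]) (eqs k)) @
     map (\<lambda>s. along (pos_path s) \<langle>IsNil\<rangle>) (nils k)"

primrec rule_incl :: "rule \<Rightarrow> inclusion" where
  "rule_incl (k, pps) = Incl (conjs (rule_body k (snd pps))) \<langle>Der (fst pps)\<rangle>"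

text \<open>The guard by mode 0 switches the inclusion off in every other mode, where derivation
  labels may then be placed arbitrarily. The last two conjuncts say that the argument is the
  one-element list of the input.\<close>

definition goal_incl :: "prog \<Rightarrow> inclusion" where
  "goal_incl p = Incl (conjs [\<langle>Root\<rangle>, along [Pick] \<langle>Mode 0\<rangle>, \<langle>Der p\<rangle>,
     along [Fld Arg, Dir Hd] \<langle>IsInput\<rangle>, along [Fld Arg, Dir Tl] \<langle>IsNil\<rangle>]) \<langle>Goal\<rangle>"

text \<open>The linked list \<open>num n\<close> written as a concept, so that its code is obtained
  from \<open>n\<close> by primitive recursion.\<close>

primrec chain :: "nat \<Rightarrow> concept" where
  "chain 0 = \<langle>IsNil\<rangle>"
| "chain (Suc n) = Conj (along [Dir Hd] \<langle>IsNil\<rangle>) (along [Dir Tl] (chain n))"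

definition program_ontology :: "rule list \<Rightarrow> prog \<Rightarrow> inclusion list" where
  "program_ontology R p = goal_incl p # map rule_incl R @ base_incls"

text \<open>Everything but the first inclusion is independent of \<open>n\<close>. Hence
  \<open>n\<close> may be chosen as the code of the rest, and prepending one element is a single
  pairing step on list codes.\<close>

definition input_ontology :: "nat \<Rightarrow> rule list \<Rightarrow> prog \<Rightarrow> inclusion list" where
  "input_ontology n R p = Incl (chain n) \<langle>IsInput\<rangle> # program_ontology R p"

definition signature :: "symbol list" where
  "signature = map (\<lambda>A. CSym (to_nat A)) closed_concepts @ map (\<lambda>e. RSym (to_nat e)) closed_roles"

definition closed_queries :: "query list" where
  "closed_queries = map (\<lambda>A. Query [0] [catom A 0]) closed_concepts @
     map (\<lambda>e. Query [0, 1] [ratom e 0 1]) closed_roles"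

definition goal_query :: query where
  "goal_query = Query [0] [catom Goal 0]"

section \<open>First-order meaning of the inclusions and the closed queries\<close>

primrec reach :: "inst \<Rightarrow> rsym list \<Rightarrow> const \<Rightarrow> const \<Rightarrow> bool" where
  "reach I [] x y \<longleftrightarrow> x = y"
| "reach I (e # es) x y \<longleftrightarrow> (\<exists>z. ratom e x z \<in> I \<and> reach I es z y)"

lemma concept_ext_along:
  "x \<in> concept_ext I (along es C) \<longleftrightarrow> (\<exists>y. reach I es x y \<and> y \<in> concept_ext I C)"
  by (induction es arbitrary: x) auto

lemma adom_iff:
  "x \<in> adom I \<longleftrightarrow> (\<exists>A. CAtom A x \<in> I) \<or> (\<exists>r y. RAtom r x y \<in> I \<or> RAtom r y x \<in> I)"
proof
  assume "x \<in> adom I"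
  then obtain a where "a \<in> I" "x \<in> set_atom a" unfolding adom_def by blast
  then show "(\<exists>A. CAtom A x \<in> I) \<or> (\<exists>r y. RAtom r x y \<in> I \<or> RAtom r y x \<in> I)"
    by (cases a) auto
qed (force simp: adom_def)

lemma concept_ext_subset_adom: "concept_ext I C \<subseteq> adom I"
proof (induction C)
  case (Ex p C)
  then show ?case by (cases p) (auto simp: adom_iff)
qed (auto simp: adom_iff)

lemma concept_ext_conjs:
  "x \<in> concept_ext I (conjs Cs) \<longleftrightarrow> x \<in> adom I \<and> (\<forall>C\<in>set Cs. x \<in> concept_ext I C)"
  by (induction Cs) (auto dest: subsetD[OF concept_ext_subset_adom])

lemma set_kinds [simp]: "set kinds = UNIV"
proof -
  have "k \<in> set kinds" for k by (cases k) (simp_all add: kinds_def)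
  then show ?thesis by blast
qed

lemma set_egds:
  "set egds = {(Top, [e], [e]) | e. e \<in> set closed_roles} \<union>
     {(\<langle>Kind k\<rangle>, pos_path s, pos_path t) | k s t. (s, t) \<in> set (eqs k)}"
  by (fastforce simp: egds_def)

lemma pos_path_closed: "pos_index s \<le> 2 \<Longrightarrow> set (pos_path s) \<subseteq> set closed_roles"
proof (cases s)
  case (At i fl ds)
  assume "pos_index s \<le> 2"
  then have "i = 0 \<or> i = 1 \<or> i = 2" using At by auto
  moreover have "Fld fl \<in> set closed_roles" by (cases fl) (auto simp: closed_roles_def)
  moreover have "Dir d \<in> set closed_roles" for d by (cases d) (auto simp: closed_roles_def)
  ultimately show ?thesis unfolding At by (auto simp: closed_roles_def)
qed

lemma pos_index_le:
  "(s, t) \<in> set (eqs k) \<Longrightarrow> pos_index s \<le> 2 \<and> pos_index t \<le> 2"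
  "s \<in> set (nils k) \<Longrightarrow> pos_index s \<le> 2"
  by (cases k; auto)+

text \<open>Consequently the ends of these paths are the same in an instance and in each of its
  closed-world models.\<close>

lemma egds_closed:
  "(C, es, es') \<in> set egds \<Longrightarrow> set es \<subseteq> set closed_roles \<and> set es' \<subseteq> set closed_roles"
  using pos_index_le(1) pos_path_closed unfolding set_egds by fastforce

lemma ans_closed_queries:
  "ans I (Query [0] [CAtom A 0]) = {[c] | c. CAtom A c \<in> I}"
  "ans I (Query [0, 1] [RAtom r 0 1]) = {[c, d] | c d. RAtom r c d \<in> I}"
proof -
  show "ans I (Query [0] [CAtom A 0]) = {[c] | c. CAtom A c \<in> I}"
    by (auto intro: exI[of _ "\<lambda>_. _"])
  have "\<exists>h. [c, d] = [h 0, h (1::nat)] \<and> RAtom r (h 0) (h 1) \<in> I" if "RAtom r c d \<in> I" for c d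
    using that by (intro exI[of _ "\<lambda>v. if v = 0 then c else d"]) auto
  then show "ans I (Query [0, 1] [RAtom r 0 1]) = {[c, d] | c d. RAtom r c d \<in> I}"
    by auto
qed

lemma ans_goal_query: "ans I goal_query = {} \<longleftrightarrow> (\<forall>c. catom Goal c \<notin> I)"
  unfolding goal_query_def ans_closed_queries by auto

lemma closed_queries_eq_iff:
  "(\<forall>q\<in>set closed_queries. ans J q = ans I q) \<longleftrightarrow>
     (\<forall>A\<in>set closed_concepts. \<forall>x. catom A x \<in> J \<longleftrightarrow> catom A x \<in> I) \<and>
     (\<forall>e\<in>set closed_roles. \<forall>x y. ratom e x y \<in> J \<longleftrightarrow> ratom e x y \<in> I)"
proof -
  have "{[c] | c. P c} = {[c] | c. Q c} \<longleftrightarrow> (\<forall>c. P c \<longleftrightarrow> Q c)" for P Q :: "nat \<Rightarrow> bool"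
    by blast
  moreover have "{[c, d] | c d. P c d} = {[c, d] | c d. Q c d} \<longleftrightarrow> (\<forall>c d. P c d \<longleftrightarrow> Q c d)"
    for P Q :: "nat \<Rightarrow> nat \<Rightarrow> bool"
    by blast
  ultimately show ?thesis
    unfolding closed_queries_def set_append ball_Un set_map ball_simps(9) ans_closed_queries
    by (simp only:)
qed

primrec is_open :: "csym \<Rightarrow> bool" where
  "is_open (Kind k) = False"
| "is_open IsNil = False"
| "is_open Root = False"
| "is_open AnyMode = False"
| "is_open (Mode i) = False"
| "is_open Goal = True"
| "is_open LeftEnd = True"
| "is_open RightEnd = True"
| "is_open IsInput = True"
| "is_open IsVal = True"
| "is_open (Der p) = True"

lemma closed_concepts_not_open: "A \<in> set closed_concepts \<Longrightarrow> \<not> is_open A"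
  by (auto simp: closed_concepts_def)

text \<open>The shape of all models constructed below: every root picks the same \<open>k\<close>
  and looks at everything, and \<open>lab\<close> interprets the open concepts on the existing
  elements.\<close>

definition extend :: "inst \<Rightarrow> const \<Rightarrow> (csym \<Rightarrow> const \<Rightarrow> bool) \<Rightarrow> inst" where
  "extend I k lab = I \<union> {ratom Pick s k | s. catom Root s \<in> I} \<union>
     {ratom Look s x | s x. catom Root s \<in> I \<and> x \<in> adom I} \<union>
     {catom A x | A x. is_open A \<and> x \<in> adom I \<and> lab A x}"

text \<open>What the existence of a closed-world model says about the closed symbols of the instance
  itself.\<close>

definition consistent :: "inst \<Rightarrow> bool" where
  "consistent I \<longleftrightarrow>
     (\<forall>i\<in>set modes. \<forall>x. catom (Mode i) x \<in> I \<longrightarrow> catom AnyMode x \<in> I) \<and>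
     (\<forall>s. catom Root s \<in> I \<longrightarrow> (\<forall>i\<in>set modes. \<exists>x. catom (Mode i) x \<in> I)) \<and>
     (\<forall>i\<in>set modes. \<forall>j\<in>set modes. \<forall>x. catom (Mode i) x \<in> I \<and> catom (Mode j) x \<in> I \<longrightarrow> i = j) \<and>
     (\<forall>x y. catom IsNil x \<in> I \<longrightarrow> ratom (Dir Hd) x y \<notin> I) \<and>
     (\<forall>x y. catom IsNil x \<in> I \<longrightarrow> ratom (Dir Tl) x y \<notin> I)"

primrec satisfies :: "inst \<Rightarrow> inclusion \<Rightarrow> bool" where
  "satisfies I (Incl C D) \<longleftrightarrow> concept_ext I C \<subseteq> concept_ext I D"

lemma model_iff_satisfies: "model I \<phi> \<longleftrightarrow> (\<forall>i\<in>\<phi>. satisfies I i)"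
proof -
  have "satisfies I i \<longleftrightarrow> (\<forall>C D. i = Incl C D \<longrightarrow> concept_ext I C \<subseteq> concept_ext I D)" for i
    by (cases i) simp
  then show ?thesis unfolding model_def by blast
qed

lemma ratom_adom: "ratom e x y \<in> I \<Longrightarrow> x \<in> adom I \<and> y \<in> adom I"
  by (auto simp: adom_iff)

lemma reach_adom: "reach I es x y \<Longrightarrow> x \<in> adom I \<longleftrightarrow> y \<in> adom I"
  by (induction es arbitrary: x) (auto dest: ratom_adom)

lemma reach_pos_path_adom: "reach I (pos_path s) x y \<Longrightarrow> x \<in> adom I \<and> y \<in> adom I"
proof -
  assume r: "reach I (pos_path s) x y"
  obtain e es where "pos_path s = e # es" by (cases s; cases "case s of At i fl ds \<Rightarrow> i") auto
  with r have "x \<in> adom I" by (auto dest: ratom_adom)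
  with reach_adom[OF r] show ?thesis by blast
qed

lemma satisfies_egd_incl:
  "satisfies J (egd_incl i (C, es, es')) \<longleftrightarrow>
     (\<forall>s k. ratom Pick s k \<in> J \<and> catom (Mode (Suc i)) k \<in> J \<longrightarrow>
        (\<exists>x y z. ratom Look s x \<in> J \<and> x \<in> concept_ext J C \<and>
          reach J es x y \<and> catom LeftEnd y \<in> J \<and> reach J es' x z \<and> catom RightEnd z \<in> J))"
proof -
  have reach1: "reach J [e] x y \<longleftrightarrow> ratom e x y \<in> J" for e x y by simp
  have body: "x \<in> concept_ext J (conjs [C, along es \<langle>LeftEnd\<rangle>, along es' \<langle>RightEnd\<rangle>]) \<longleftrightarrow>
      x \<in> concept_ext J C \<and> (\<exists>y. reach J es x y \<and> catom LeftEnd y \<in> J) \<and>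
      (\<exists>z. reach J es' x z \<and> catom RightEnd z \<in> J)" for x
    unfolding concept_ext_conjs list.set ball_simps concept_ext_along concept_ext.simps mem_Collect_eq
    using concept_ext_subset_adom[of J C] by blast
  show ?thesis
    unfolding egd_incl_def prod.case satisfies.simps subset_iff concept_ext_along reach1 body
      concept_ext.simps mem_Collect_eq
    by blast
qed

lemma model_base_iff:
  "model J (set base_incls) \<longleftrightarrow>
     (\<forall>i\<in>set modes. \<forall>x. catom (Mode i) x \<in> J \<longrightarrow> catom AnyMode x \<in> J) \<and>
     (\<forall>i\<in>set modes. \<forall>s. catom Root s \<in> J \<longrightarrow> (\<exists>x. ratom Look s x \<in> J \<and> catom (Mode i) x \<in> J)) \<and>
     (\<forall>i\<in>set modes. \<forall>j\<in>set modes. i \<noteq> j \<longrightarrow> (\<forall>x. catom (Mode i) x \<in> J \<longrightarrow> catom (Mode j) x \<notin> J)) \<and>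
     (\<forall>i<length egds. case egds ! i of (C, es, es') \<Rightarrow>
        (\<forall>s k. ratom Pick s k \<in> J \<and> catom (Mode (Suc i)) k \<in> J \<longrightarrow>
          (\<exists>x y z. ratom Look s x \<in> J \<and> x \<in> concept_ext J C \<and>
            reach J es x y \<and> catom LeftEnd y \<in> J \<and> reach J es' x z \<and> catom RightEnd z \<in> J))) \<and>
     (\<forall>s. catom Root s \<in> J \<longrightarrow> (\<exists>k. ratom Pick s k \<in> J \<and> catom AnyMode k \<in> J)) \<and>
     (\<forall>x. catom LeftEnd x \<in> J \<and> catom RightEnd x \<in> J \<longrightarrow> catom Goal x \<in> J) \<and>
     (\<forall>x y. catom IsNil x \<in> J \<longrightarrow> ratom (Dir Hd) x y \<notin> J) \<and>
     (\<forall>x y. catom IsNil x \<in> J \<longrightarrow> ratom (Dir Tl) x y \<notin> J) \<and>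
     (\<forall>x. catom IsNil x \<in> J \<longrightarrow> catom IsVal x \<in> J) \<and>
     (\<forall>x y z. ratom (Dir Hd) x y \<in> J \<and> catom IsVal y \<in> J \<and> ratom (Dir Tl) x z \<in> J \<and>
        catom IsVal z \<in> J \<longrightarrow> catom IsVal x \<in> J)"
proof -
  have ball_modes: "(\<forall>x\<in>set [0..<n]. P x) \<longleftrightarrow> (\<forall>x<n. P x)" for n P by auto
  show ?thesis
    unfolding base_incls_def model_iff_satisfies set_append ball_Un set_map ball_simps(9)
  proof (intro conj_cong)
    show "(\<forall>i\<in>set modes. satisfies J (Incl \<langle>Mode i\<rangle> \<langle>AnyMode\<rangle>)) \<longleftrightarrow>
      (\<forall>i\<in>set modes. \<forall>x. catom (Mode i) x \<in> J \<longrightarrow> catom AnyMode x \<in> J)"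
      by (auto simp del: upt_Suc)
  next
    show "(\<forall>i\<in>set modes. satisfies J (Incl \<langle>Root\<rangle> (along [Look] \<langle>Mode i\<rangle>))) \<longleftrightarrow>
      (\<forall>i\<in>set modes. \<forall>s. catom Root s \<in> J \<longrightarrow> (\<exists>x. ratom Look s x \<in> J \<and> catom (Mode i) x \<in> J))"
      by (auto simp del: upt_Suc)
  next
    show "(\<forall>i\<in>set [Incl (Conj \<langle>Mode i\<rangle> \<langle>Mode j\<rangle>) Bot. i \<leftarrow> modes, j \<leftarrow> modes, i \<noteq> j]. satisfies J i) \<longleftrightarrow>
      (\<forall>i\<in>set modes. \<forall>j\<in>set modes. i \<noteq> j \<longrightarrow>
        (\<forall>x. catom (Mode i) x \<in> J \<longrightarrow> catom (Mode j) x \<notin> J))"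
      by (force simp del: upt_Suc)
  next
    show "(\<forall>i\<in>set [0..<length egds]. satisfies J (egd_incl i (egds ! i))) \<longleftrightarrow>
      (\<forall>i<length egds. case egds ! i of (C, es, es') \<Rightarrow>
        (\<forall>s k. ratom Pick s k \<in> J \<and> catom (Mode (Suc i)) k \<in> J \<longrightarrow>
          (\<exists>x y z. ratom Look s x \<in> J \<and> x \<in> concept_ext J C \<and>
            reach J es x y \<and> catom LeftEnd y \<in> J \<and> reach J es' x z \<and> catom RightEnd z \<in> J)))"
      unfolding ball_modes
      by (intro all_cong) (simp add: satisfies_egd_incl split: prod.split)
  next
    show "(\<forall>i\<in>set [Incl \<langle>Root\<rangle> (along [Pick] \<langle>AnyMode\<rangle>),
        Incl (Conj \<langle>LeftEnd\<rangle> \<langle>RightEnd\<rangle>) \<langle>Goal\<rangle>,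
        Incl (Conj \<langle>IsNil\<rangle> (along [Dir Hd] Top)) Bot,
      Incl (Conj \<langle>IsNil\<rangle> (along [Dir Tl] Top)) Bot,
        Incl \<langle>IsNil\<rangle> \<langle>IsVal\<rangle>,
        Incl (Conj (along [Dir Hd] \<langle>IsVal\<rangle>) (along [Dir Tl] \<langle>IsVal\<rangle>)) \<langle>IsVal\<rangle>]. satisfies J i) \<longleftrightarrow>
      (\<forall>s. catom Root s \<in> J \<longrightarrow> (\<exists>k. ratom Pick s k \<in> J \<and> catom AnyMode k \<in> J)) \<and>
     (\<forall>x. catom LeftEnd x \<in> J \<and> catom RightEnd x \<in> J \<longrightarrow> catom Goal x \<in> J) \<and>
     (\<forall>x y. catom IsNil x \<in> J \<longrightarrow> ratom (Dir Hd) x y \<notin> J) \<and>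
     (\<forall>x y. catom IsNil x \<in> J \<longrightarrow> ratom (Dir Tl) x y \<notin> J) \<and>
     (\<forall>x. catom IsNil x \<in> J \<longrightarrow> catom IsVal x \<in> J) \<and>
     (\<forall>x y z. ratom (Dir Hd) x y \<in> J \<and> catom IsVal y \<in> J \<and> ratom (Dir Tl) x z \<in> J \<and>
        catom IsVal z \<in> J \<longrightarrow> catom IsVal x \<in> J)"
    proof -
      have reach1: "reach J [e] x y \<longleftrightarrow> ratom e x y \<in> J" for e x y by simp
      have adom: "ratom e x y \<in> J \<and> y \<in> adom J \<longleftrightarrow> ratom e x y \<in> J" for e x y
        using ratom_adom by blast
      show ?thesis
        unfolding list.set ball_simps satisfies.simps subset_iff concept_ext_along reach1
          concept_ext.simps mem_Collect_eq Int_iff adom empty_iff by blast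
    qed
  qed
qed

definition body_holds :: "inst \<Rightarrow> kind \<Rightarrow> prog list \<Rightarrow> const \<Rightarrow> bool" where
  "body_holds J k ps x \<longleftrightarrow> catom (Kind k) x \<in> J \<and>
     (\<forall>fl. \<exists>y. ratom (Fld fl) x y \<in> J \<and> catom IsVal y \<in> J) \<and>
     (\<forall>i<length ps. \<exists>y. ratom (Premise i) x y \<in> J \<and> catom (Der (ps ! i)) y \<in> J) \<and>
     (\<forall>(s, t)\<in>set (eqs k). (\<exists>y. reach J (pos_path s) x y) \<and> (\<exists>y. reach J (pos_path t) x y)) \<and>
     (\<forall>s\<in>set (nils k). \<exists>y. reach J (pos_path s) x y \<and> catom IsNil y \<in> J)"

lemma all_field: "(\<forall>fl. P fl) \<longleftrightarrow> P Arg \<and> P Res"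
  by (metis field.exhaust)

lemma concept_ext_rule_body: "x \<in> concept_ext J (conjs (rule_body k ps)) \<longleftrightarrow> body_holds J k ps x"
proof -
  have "x \<in> concept_ext J (along (pos_path s) Top) \<longleftrightarrow> (\<exists>y. reach J (pos_path s) x y)" for s
    unfolding concept_ext_along by (auto dest: reach_pos_path_adom)
  moreover have "(\<forall>C\<in>set (concat (map (\<lambda>(s, t). [f s, f t]) xs)). P C) \<longleftrightarrow> (\<forall>(s, t)\<in>set xs. P (f s) \<and> P (f t))"
    for f :: "pos \<Rightarrow> concept" and P xs by auto
  moreover have "catom (Kind k) x \<in> J \<Longrightarrow> x \<in> adom J"
    by (auto simp: adom_iff)
  ultimately show ?thesis
    unfolding concept_ext_conjs rule_body_def body_holds_def set_append ball_Un all_field set_map ball_simps(9)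
    by (auto simp: concept_ext_along)
qed

lemma model_input_ontology_iff:
  "model J (set (input_ontology n R p)) \<longleftrightarrow>
     concept_ext J (chain n) \<subseteq> {x. catom IsInput x \<in> J} \<and>
     (\<forall>x k y z. catom Root x \<in> J \<and> ratom Pick x k \<in> J \<and> catom (Mode 0) k \<in> J \<and> catom (Der p) x \<in> J \<and>
        reach J [Fld Arg, Dir Hd] x y \<and> catom IsInput y \<in> J \<and>
        reach J [Fld Arg, Dir Tl] x z \<and> catom IsNil z \<in> J \<longrightarrow> catom Goal x \<in> J) \<and>
     (\<forall>(k, q, ps)\<in>set R. \<forall>x. body_holds J k ps x \<longrightarrow> catom (Der q) x \<in> J) \<and>
     model J (set base_incls)"
proof -
  have input: "satisfies J (Incl (chain n) \<langle>IsInput\<rangle>) \<longleftrightarrow> concept_ext J (chain n) \<subseteq> {x. catom IsInput x \<in> J}"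
    by simp
  have adom: "x \<in> adom J" if "catom Root x \<in> J" for x
    using that by (auto simp: adom_iff)
  have Pick: "reach J [Pick] x k \<longleftrightarrow> ratom Pick x k \<in> J" for x k by simp
  have body: "x \<in> concept_ext J (conjs [\<langle>Root\<rangle>, along [Pick] \<langle>Mode 0\<rangle>, \<langle>Der p\<rangle>,
      along [Fld Arg, Dir Hd] \<langle>IsInput\<rangle>, along [Fld Arg, Dir Tl] \<langle>IsNil\<rangle>]) \<longleftrightarrow>
      catom Root x \<in> J \<and> (\<exists>k. ratom Pick x k \<in> J \<and> catom (Mode 0) k \<in> J) \<and> catom (Der p) x \<in> J \<and>
      (\<exists>y. reach J [Fld Arg, Dir Hd] x y \<and> catom IsInput y \<in> J) \<and>
      (\<exists>z. reach J [Fld Arg, Dir Tl] x z \<and> catom IsNil z \<in> J)" for x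
    unfolding concept_ext_conjs list.set ball_simps concept_ext_along concept_ext.simps mem_Collect_eq Pick
    using adom by blast
  have goal: "satisfies J (goal_incl p) \<longleftrightarrow>
     (\<forall>x k y z. catom Root x \<in> J \<and> ratom Pick x k \<in> J \<and> catom (Mode 0) k \<in> J \<and> catom (Der p) x \<in> J \<and>
        reach J [Fld Arg, Dir Hd] x y \<and> catom IsInput y \<in> J \<and>
        reach J [Fld Arg, Dir Tl] x z \<and> catom IsNil z \<in> J \<longrightarrow> catom Goal x \<in> J)"
    unfolding goal_incl_def satisfies.simps subset_iff body concept_ext.simps mem_Collect_eq
    by blast
  have rules: "(\<forall>i\<in>set (map rule_incl R). satisfies J i) \<longleftrightarrow>
    (\<forall>(k, q, ps)\<in>set R. \<forall>x. body_holds J k ps x \<longrightarrow> catom (Der q) x \<in> J)"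
    by (auto simp: subset_iff concept_ext_rule_body split: prod.splits)
  show ?thesis
    unfolding input_ontology_def program_ontology_def model_iff_satisfies append.simps list.set(2)
      set_append ball_Un ball_simps(7) input goal rules ..
qed

section \<open>Avoiding the goal when there is no derivation\<close>

lemma over_catom: "over I (set signature) \<Longrightarrow> catom A x \<in> I \<Longrightarrow> A \<in> set closed_concepts"
  by (force simp: over_def signature_def)

lemma over_ratom: "over I (set signature) \<Longrightarrow> ratom e x y \<in> I \<Longrightarrow> e \<in> set closed_roles"
  by (force simp: over_def signature_def)

lemma catom_extend:
  "catom A x \<in> extend I k lab \<longleftrightarrow> catom A x \<in> I \<or> is_open A \<and> x \<in> adom I \<and> lab A x"
  by (auto simp: extend_def)

lemma ratom_extend:
  "ratom e x y \<in> extend I k lab \<longleftrightarrow> ratom e x y \<in> I \<or>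
     catom Root x \<in> I \<and> (e = Pick \<and> y = k \<or> e = Look \<and> y \<in> adom I)"
  by (auto simp: extend_def)

lemma closed_roles_not_Pick: "e \<in> set closed_roles \<Longrightarrow> e \<noteq> Pick \<and> e \<noteq> Look"
  by (auto simp: closed_roles_def)

lemma adom_extend:
  assumes "\<And>s. catom Root s \<in> I \<Longrightarrow> k \<in> adom I"
  shows "adom (extend I k lab) = adom I"
proof
  show "adom (extend I k lab) \<subseteq> adom I"
  proof
    fix x assume "x \<in> adom (extend I k lab)"
    then obtain a where a: "a \<in> extend I k lab" "x \<in> set_atom a" by (auto simp: adom_def)
    have "s \<in> adom I" if "catom Root s \<in> I" for s
      using that by (auto simp: adom_iff)
    with a assms show "x \<in> adom I" by (auto simp: extend_def) (auto simp: adom_def)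
  qed
  show "adom I \<subseteq> adom (extend I k lab)"
    by (auto simp: adom_def extend_def)
qed

lemma reach_extend: "set es \<subseteq> set closed_roles \<Longrightarrow> reach (extend I k lab) es x y \<longleftrightarrow> reach I es x y"
  by (induction es arbitrary: x) (auto simp: ratom_extend dest: closed_roles_not_Pick)

lemma chain_extend: "concept_ext (extend I k lab) (chain n) = concept_ext I (chain n)"
  by (induction n) (auto simp: catom_extend ratom_extend)

lemma body_extend:
  assumes "over I (set signature)" "length ps \<le> 2" "body_holds (extend I k lab) kd ps x"
  shows "catom (Kind kd) x \<in> I"
    and "\<exists>y. ratom (Fld fl) x y \<in> I \<and> lab IsVal y"
    and "i < length ps \<Longrightarrow> \<exists>y. ratom (Premise i) x y \<in> I \<and> lab (Der (ps ! i)) y"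
    and "(s, t) \<in> set (eqs kd) \<Longrightarrow> (\<exists>y. reach I (pos_path s) x y) \<and> (\<exists>y. reach I (pos_path t) x y)"
    and "s \<in> set (nils kd) \<Longrightarrow> \<exists>y. reach I (pos_path s) x y \<and> catom IsNil y \<in> I"
proof -
  have no_open: "catom A y \<notin> I" if "is_open A" for A y
    using over_catom[OF assms(1)] closed_concepts_not_open that by blast
  note b = assms(3)[unfolded body_holds_def]
  show "catom (Kind kd) x \<in> I" using b by (simp add: catom_extend)
  show "\<exists>y. ratom (Fld fl) x y \<in> I \<and> lab IsVal y"
    using b no_open by (auto simp: catom_extend ratom_extend)
  show "i < length ps \<Longrightarrow> \<exists>y. ratom (Premise i) x y \<in> I \<and> lab (Der (ps ! i)) y"
    using b no_open by (fastforce simp: catom_extend ratom_extend)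
  show "(s, t) \<in> set (eqs kd) \<Longrightarrow> (\<exists>y. reach I (pos_path s) x y) \<and> (\<exists>y. reach I (pos_path t) x y)"
    using b pos_index_le(1)[of s t kd] reach_extend[OF pos_path_closed] by fastforce
  show "s \<in> set (nils kd) \<Longrightarrow> \<exists>y. reach I (pos_path s) x y \<and> catom IsNil y \<in> I"
    using b pos_index_le(2)[of s kd] reach_extend[OF pos_path_closed] by (fastforce simp: catom_extend)
qed

lemma concept_ext_egd_extend:
  assumes "(C, es, es') \<in> set egds" "\<And>s. catom Root s \<in> I \<Longrightarrow> k \<in> adom I"
  shows "concept_ext (extend I k lab) C = concept_ext I C"
  using assms adom_extend[OF assms(2)] by (auto simp: set_egds catom_extend)

text \<open>Reduces the model check to conditions on \<open>lab\<close>. As all roots pick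
  \<open>k\<close>, whose only mode is \<open>m\<close>, a violation has to be exhibited only for
  the one equality with index \<open>m - 1\<close>, and the goal inclusion matters only if
  \<open>m = 0\<close>.\<close>

lemma extend_CWA:
  assumes over: "over I (set signature)" and cons: "consistent I"
    and m: "m \<in> set modes" and k: "\<And>s. catom Root s \<in> I \<Longrightarrow> catom (Mode m) k \<in> I"
    and egd: "\<And>s i C es es'. catom Root s \<in> I \<Longrightarrow> m = Suc i \<Longrightarrow> egds ! i = (C, es, es') \<Longrightarrow>
      \<exists>x y z. x \<in> concept_ext I C \<and> reach I es x y \<and> lab LeftEnd y \<and> reach I es' x z \<and> lab RightEnd z"
    and ends: "\<And>x. x \<in> adom I \<Longrightarrow> lab LeftEnd x \<Longrightarrow> lab RightEnd x \<Longrightarrow> lab Goal x"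
    and val_nil: "\<And>x. catom IsNil x \<in> I \<Longrightarrow> lab IsVal x"
    and val_pair: "\<And>x y z. ratom (Dir Hd) x y \<in> I \<Longrightarrow> ratom (Dir Tl) x z \<in> I \<Longrightarrow>
      lab IsVal y \<Longrightarrow> lab IsVal z \<Longrightarrow> lab IsVal x"
    and rules: "\<And>kd p ps x. (kd, p, ps) \<in> set R \<Longrightarrow> body_holds (extend I k lab) kd ps x \<Longrightarrow> lab (Der p) x"
    and goal: "\<And>x y z. m = 0 \<Longrightarrow> catom Root x \<in> I \<Longrightarrow> lab (Der p) x \<Longrightarrow> reach I [Fld Arg, Dir Hd] x y \<Longrightarrow>
      lab IsInput y \<Longrightarrow> reach I [Fld Arg, Dir Tl] x z \<Longrightarrow> catom IsNil z \<in> I \<Longrightarrow> lab Goal x"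
    and inp: "\<And>x. x \<in> concept_ext I (chain n) \<Longrightarrow> lab IsInput x"
  shows "extend I k lab \<in> CWA (set (input_ontology n R p)) I (set closed_queries)"
proof -
  let ?J = "extend I k lab"
  note [simp del] = upt_Suc reach.simps
  have no_open: "catom A y \<notin> I" if "is_open A" for A y
    using over_catom[OF over] closed_concepts_not_open that by blast
  \<comment> \<open>Both roles lie outside the signature, so \<open>k\<close> is the only element
    picked in the extension.\<close>
  have no_pick: "ratom Pick x y \<notin> I" "ratom Look x y \<notin> I" for x y
    using over_ratom[OF over] closed_roles_not_Pick by blast+
  have k_adom: "k \<in> adom I" if "catom Root s \<in> I" for s
    using k[OF that] by (auto simp: adom_iff)
  have mode: "i = m" if "catom Root s \<in> I" "catom (Mode i) k \<in> I" for i s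
  proof -
    have "i \<in> set modes" using over_catom[OF over that(2)] by (auto simp: closed_concepts_def)
    with cons m k[OF that(1)] that(2) show ?thesis unfolding consistent_def by blast
  qed
  have closed: "\<forall>q\<in>set closed_queries. ans ?J q = ans I q"
    unfolding closed_queries_eq_iff catom_extend ratom_extend
    using closed_concepts_not_open closed_roles_not_Pick by blast
  have base: "model ?J (set base_incls)"
    unfolding model_base_iff
  proof (intro conjI)
    show "\<forall>i\<in>set modes. \<forall>x. catom (Mode i) x \<in> ?J \<longrightarrow> catom AnyMode x \<in> ?J"
      using cons by (auto simp: consistent_def catom_extend)
    show "\<forall>i\<in>set modes. \<forall>s. catom Root s \<in> ?J \<longrightarrow> (\<exists>x. ratom Look s x \<in> ?J \<and> catom (Mode i) x \<in> ?J)"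
    proof (intro ballI allI impI)
      fix i s assume "i \<in> set modes" "catom Root s \<in> ?J"
      then have s: "catom Root s \<in> I" by (simp add: catom_extend)
      then obtain x where "catom (Mode i) x \<in> I"
        using cons \<open>i \<in> set modes\<close> unfolding consistent_def by blast
      moreover from this have "x \<in> adom I" by (auto simp: adom_iff)
      ultimately show "\<exists>x. ratom Look s x \<in> ?J \<and> catom (Mode i) x \<in> ?J"
        using s by (auto simp: catom_extend ratom_extend)
    qed
    show "\<forall>i\<in>set modes. \<forall>j\<in>set modes. i \<noteq> j \<longrightarrow>
        (\<forall>x. catom (Mode i) x \<in> ?J \<longrightarrow> catom (Mode j) x \<notin> ?J)"
      unfolding catom_extend is_open.simps using cons[unfolded consistent_def] by blast
    show "\<forall>i<length egds. case egds ! i of (C, es, es') \<Rightarrow>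
        (\<forall>s k'. ratom Pick s k' \<in> ?J \<and> catom (Mode (Suc i)) k' \<in> ?J \<longrightarrow>
          (\<exists>x y z. ratom Look s x \<in> ?J \<and> x \<in> concept_ext ?J C \<and>
            reach ?J es x y \<and> catom LeftEnd y \<in> ?J \<and> reach ?J es' x z \<and> catom RightEnd z \<in> ?J))"
    proof (intro allI impI, clarify)
      fix i C es es' s k' assume i: "i < length egds" "egds ! i = (C, es, es')"
        and s: "ratom Pick s k' \<in> ?J" and k': "catom (Mode (Suc i)) k' \<in> ?J"
      have root: "catom Root s \<in> I" "k' = k" using s no_pick by (auto simp: ratom_extend)
      then have "m = Suc i" using mode k' by (auto simp: catom_extend)
      with egd[OF root(1)] i(2) obtain x y z where
        "x \<in> concept_ext I C" "reach I es x y" "lab LeftEnd y" "reach I es' x z" "lab RightEnd z" by blast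
      moreover have e: "(C, es, es') \<in> set egds" using i by (metis nth_mem)
      moreover have "x \<in> adom I" using calculation(1) concept_ext_subset_adom by blast
      moreover from this have "y \<in> adom I" "z \<in> adom I" using calculation reach_adom by blast+
      ultimately show "\<exists>x y z. ratom Look s x \<in> ?J \<and> x \<in> concept_ext ?J C \<and>
            reach ?J es x y \<and> catom LeftEnd y \<in> ?J \<and> reach ?J es' x z \<and> catom RightEnd z \<in> ?J"
        using root(1) egds_closed[OF e]
        by (auto simp: catom_extend ratom_extend reach_extend concept_ext_egd_extend[OF e k_adom])
    qed
    show "\<forall>s. catom Root s \<in> ?J \<longrightarrow> (\<exists>k'. ratom Pick s k' \<in> ?J \<and> catom AnyMode k' \<in> ?J)"
      using cons m k by (auto simp: consistent_def catom_extend ratom_extend)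
    show "\<forall>x. catom LeftEnd x \<in> ?J \<and> catom RightEnd x \<in> ?J \<longrightarrow> catom Goal x \<in> ?J"
      using ends no_open by (auto simp: catom_extend)
    show "\<forall>x y. catom IsNil x \<in> ?J \<longrightarrow> ratom (Dir Hd) x y \<notin> ?J"
      "\<forall>x y. catom IsNil x \<in> ?J \<longrightarrow> ratom (Dir Tl) x y \<notin> ?J"
      using cons by (auto simp: consistent_def catom_extend ratom_extend)
    show "\<forall>x. catom IsNil x \<in> ?J \<longrightarrow> catom IsVal x \<in> ?J"
      using val_nil by (auto simp: catom_extend adom_iff)
    show "\<forall>x y z. ratom (Dir Hd) x y \<in> ?J \<and> catom IsVal y \<in> ?J \<and> ratom (Dir Tl) x z \<in> ?J \<and>
        catom IsVal z \<in> ?J \<longrightarrow> catom IsVal x \<in> ?J"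
      using val_pair no_open by (auto simp: catom_extend ratom_extend dest: ratom_adom)
  qed
  have "model ?J (set (input_ontology n R p))"
    unfolding model_input_ontology_iff
  proof (intro conjI base)
    show "concept_ext ?J (chain n) \<subseteq> {x. catom IsInput x \<in> ?J}"
      using inp concept_ext_subset_adom by (fastforce simp: chain_extend catom_extend)
    show "\<forall>x k' y z. catom Root x \<in> ?J \<and> ratom Pick x k' \<in> ?J \<and> catom (Mode 0) k' \<in> ?J \<and> catom (Der p) x \<in> ?J \<and>
        reach ?J [Fld Arg, Dir Hd] x y \<and> catom IsInput y \<in> ?J \<and>
        reach ?J [Fld Arg, Dir Tl] x z \<and> catom IsNil z \<in> ?J \<longrightarrow> catom Goal x \<in> ?J"
    proof (intro allI impI, elim conjE)
      fix x k' y z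
      assume a: "catom Root x \<in> ?J" "ratom Pick x k' \<in> ?J" "catom (Mode 0) k' \<in> ?J" "catom (Der p) x \<in> ?J"
        "reach ?J [Fld Arg, Dir Hd] x y" "catom IsInput y \<in> ?J"
        "reach ?J [Fld Arg, Dir Tl] x z" "catom IsNil z \<in> ?J"
      have x: "catom Root x \<in> I" using a by (simp add: catom_extend)
      have "k' = k" using a(2) no_pick by (auto simp: ratom_extend)
      then have "m = 0" using mode[OF x] a(3) by (auto simp: catom_extend)
      moreover have "reach I [Fld Arg, Dir Hd] x y" "reach I [Fld Arg, Dir Tl] x z"
        by (rule reach_extend[THEN iffD1, OF _ a(5)] reach_extend[THEN iffD1, OF _ a(7)];
            simp add: closed_roles_def)+
      moreover have "lab (Der p) x" "lab IsInput y" "catom IsNil z \<in> I"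
        using a no_open by (auto simp: catom_extend)
      ultimately have "lab Goal x" using goal x by blast
      moreover have "x \<in> adom I" using x by (auto simp: adom_iff)
      ultimately show "catom Goal x \<in> ?J" by (simp add: catom_extend)
    qed
    have "x \<in> adom I" if "body_holds ?J kd ps x" for kd ps x
    proof -
      have "catom (Kind kd) x \<in> I" using that by (simp add: body_holds_def catom_extend)
      then show ?thesis by (auto simp: adom_iff)
    qed
    then show "\<forall>(kd, q, ps)\<in>set R. \<forall>x. body_holds ?J kd ps x \<longrightarrow> catom (Der q) x \<in> ?J"
      using rules by (auto simp: catom_extend)
  qed
  moreover have "I \<subseteq> ?J" by (auto simp: extend_def)
  ultimately show ?thesis
    using closed unfolding CWA_def by blast
qed

section \<open>Values and derivations read off an instance\<close>

definition wf_rules :: "rule set \<Rightarrow> bool" where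
  "wf_rules R \<longleftrightarrow> (\<forall>(k, p, ps)\<in>R. length ps \<le> 2 \<and>
     (\<forall>(s, t)\<in>set (eqs k). pos_index s \<le> length ps \<and> pos_index t \<le> length ps) \<and>
     (\<forall>s\<in>set (nils k). pos_index s \<le> length ps))"

definition satisfies_egds :: "inst \<Rightarrow> bool" where
  "satisfies_egds I \<longleftrightarrow> (\<forall>(C, es, es')\<in>set egds. \<forall>x y z.
     x \<in> concept_ext I C \<and> reach I es x y \<and> reach I es' x z \<longrightarrow> y = z)"

text \<open>Being inductive, it assigns no value to an element whose unfolding is infinite. It
  provides the interpretation of \<open>IsVal\<close> in mode 0.\<close>

inductive rep :: "inst \<Rightarrow> const \<Rightarrow> val \<Rightarrow> bool" for I where
  rep_Nul: "catom IsNil x \<in> I \<Longrightarrow> rep I x Nul"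
| rep_Pr: "ratom (Dir Hd) x y \<in> I \<Longrightarrow> ratom (Dir Tl) x z \<in> I \<Longrightarrow> rep I y u \<Longrightarrow> rep I z w \<Longrightarrow>
    rep I x (Pr u w)"

definition rep_judgement :: "inst \<Rightarrow> const \<Rightarrow> judgement \<Rightarrow> bool" where
  "rep_judgement I x j \<longleftrightarrow> (\<forall>fl. \<exists>y. ratom (Fld fl) x y \<in> I \<and> rep I y (field_val fl j))"

lemma egds_functional:
  assumes "satisfies_egds I" "e \<in> set closed_roles" "ratom e x y \<in> I" "ratom e x z \<in> I"
  shows "y = z"
proof -
  have "(Top, [e], [e]) \<in> set egds" using assms(2) by (simp add: set_egds)
  moreover have "x \<in> concept_ext I Top" using ratom_adom[OF assms(3)] by simp
  ultimately show ?thesis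
    using assms(1,3,4) unfolding satisfies_egds_def by fastforce
qed

text \<open>Nil elements have no components by consistency, and components are unique by the
  functionality equalities.\<close>

lemma rep_unique:
  assumes "satisfies_egds I" "consistent I"
  shows "rep I x v \<Longrightarrow> rep I x w \<Longrightarrow> v = w"
proof (induction arbitrary: w rule: rep.induct)
  case (rep_Nul x)
  from rep_Nul(2,1) show ?case using assms(2) by cases (auto simp: consistent_def)
next
  case (rep_Pr x y z u v)
  have fn: "ratom (Dir Hd) x y' \<in> I \<Longrightarrow> y' = y" "ratom (Dir Tl) x z' \<in> I \<Longrightarrow> z' = z" for y' z'
    using egds_functional[OF assms(1)] rep_Pr(1,2) by (auto simp: closed_roles_def)
  from rep_Pr.prems show ?case
  proof cases
    case rep_Nul
    with rep_Pr(2) assms(2) show ?thesis by (auto simp: consistent_def)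
  next
    case rep_Pr
    with fn rep_Pr.IH show ?thesis by blast
  qed
qed

lemma rep_sel:
  assumes "satisfies_egds I" "consistent I"
  shows "rep I x v \<Longrightarrow> reach I (map Dir ds) x y \<Longrightarrow> \<exists>w. sel ds v = Some w \<and> rep I y w"
proof (induction ds arbitrary: x v)
  case (Cons d ds)
  then obtain x' where x': "ratom (Dir d) x x' \<in> I" "reach I (map Dir ds) x' y" by auto
  have fn: "ratom (Dir d) x z \<in> I \<Longrightarrow> z = x'" for z
    using egds_functional[OF assms(1) _ _ x'(1)] by (cases d) (auto simp: closed_roles_def)
  from Cons.prems(1) show ?case
  proof cases
    case rep_Nul
    then have False using x'(1) assms(2) by (cases d) (auto simp: consistent_def)
    then show ?thesis ..
  next
    case (rep_Pr y' z' u w)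
    then show ?thesis using Cons.IH[OF _ x'(2)] fn by (cases d) auto
  qed
qed auto

lemma rep_pos:
  assumes "satisfies_egds I" "consistent I" and x: "rep_judgement I x j"
    and ys: "length js \<le> 2" "\<And>i. i < length js \<Longrightarrow> ratom (Premise i) x (f i) \<in> I \<and> rep_judgement I (f i) (js ! i)"
    and s: "pos_index s \<le> length js" "reach I (pos_path s) x y"
  shows "\<exists>v. val_at (j # js) s = Some v \<and> rep I y v"
proof -
  obtain i fl ds where s_def: "s = At i fl ds" by (cases s)
  have *: "\<exists>v. sel ds (field_val fl j') = Some v \<and> rep I y v"
    if x': "rep_judgement I x' j'" and r: "reach I (Fld fl # map Dir ds) x' y" for x' j'
  proof -
    obtain z where z: "ratom (Fld fl) x' z \<in> I" "reach I (map Dir ds) z y" using r by auto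
    obtain z' where z': "ratom (Fld fl) x' z' \<in> I" "rep I z' (field_val fl j')"
      using x' unfolding rep_judgement_def by blast
    have "Fld fl \<in> set closed_roles" by (cases fl) (auto simp: closed_roles_def)
    then have "z = z'" using egds_functional[OF assms(1)] z(1) z'(1) by blast
    with rep_sel[OF assms(1,2)] z z' show ?thesis by blast
  qed
  show ?thesis
  proof (cases i)
    case 0
    with *[OF x] s(2) show ?thesis by (simp add: s_def del: reach.simps(2))
  next
    case (Suc n)
    with s obtain x' where x': "ratom (Premise n) x x' \<in> I" "reach I (Fld fl # map Dir ds) x' y"
      and n: "n < length js"
      by (auto simp: s_def)
    have "Premise n \<in> set closed_roles" using n ys(1) by (auto simp: closed_roles_def)
    then have "x' = f n" using egds_functional[OF assms(1)] ys(2)[OF n] x'(1) by blast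
    with *[OF _ x'(2)] ys(2)[OF n] Suc show ?thesis by (simp add: s_def)
  qed
qed

definition derivable_at :: "inst \<Rightarrow> rule set \<Rightarrow> prog \<Rightarrow> const \<Rightarrow> bool" where
  "derivable_at I R p x \<longleftrightarrow> (\<exists>a r. rep_judgement I x (a, r) \<and> ev R p a r)"

text \<open>Interpreting \<open>Der p\<close> as genuine derivability respects the rule inclusions.
  If the equalities hold, the two path ends of an equation are one element, and since an element
  represents at most one value, the values at the two positions agree.\<close>

lemma derivable_at_rule:
  assumes egd: "satisfies_egds I" and cons: "consistent I" and wf: "wf_rules R" "(k, p, ps) \<in> R"
    and kind: "catom (Kind k) x \<in> I"
    and vals: "\<And>fl. \<exists>y. ratom (Fld fl) x y \<in> I \<and> (\<exists>v. rep I y v)"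
    and prems: "\<And>i. i < length ps \<Longrightarrow> \<exists>y. ratom (Premise i) x y \<in> I \<and> derivable_at I R (ps ! i) y"
    and eqs: "\<And>s t. (s, t) \<in> set (eqs k) \<Longrightarrow> (\<exists>y. reach I (pos_path s) x y) \<and> (\<exists>y. reach I (pos_path t) x y)"
    and nils: "\<And>s. s \<in> set (nils k) \<Longrightarrow> \<exists>y. reach I (pos_path s) x y \<and> catom IsNil y \<in> I"
  shows "derivable_at I R p x"
proof -
  obtain a r where j: "rep_judgement I x (a, r)"
    using vals[of Arg] vals[of Res] unfolding rep_judgement_def all_field by auto
  have "\<exists>y j. ratom (Premise i) x y \<in> I \<and> rep_judgement I y j \<and> ev R (ps ! i) (fst j) (snd j)"
    if "i < length ps" for i using prems[OF that] unfolding derivable_at_def by fastforce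
  then obtain f js' where f: "\<And>i. i < length ps \<Longrightarrow> ratom (Premise i) x (f i) \<in> I \<and>
      rep_judgement I (f i) (js' i) \<and> ev R (ps ! i) (fst (js' i)) (snd (js' i))"
    by metis
  define js where "js = map js' [0..<length ps]"
  note wf' = wf(1)[unfolded wf_rules_def, rule_format, OF wf(2), simplified]
  have len: "length js = length ps" by (simp add: js_def)
  have pos: "\<exists>v. val_at ((a, r) # js) s = Some v \<and> rep I y v"
    if "pos_index s \<le> length ps" "reach I (pos_path s) x y" for s y
    by (rule rep_pos[OF egd cons j, where f = f]) (use that f wf' in \<open>auto simp: js_def\<close>)
  have "holds k ((a, r) # js)"
    unfolding holds_iff
  proof safe
    fix s t assume st: "(s, t) \<in> set (eqs k)"
    then obtain y z where y: "reach I (pos_path s) x y" and z: "reach I (pos_path t) x z"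
      using eqs by blast
    have "(\<langle>Kind k\<rangle>, pos_path s, pos_path t) \<in> set egds" using st by (auto simp: set_egds)
    then have "y = z" using egd kind y z unfolding satisfies_egds_def by fastforce
    moreover have "pos_index s \<le> length ps" "pos_index t \<le> length ps" using st wf' by auto
    ultimately obtain v w where "val_at ((a, r) # js) s = Some v" "rep I y v"
      "val_at ((a, r) # js) t = Some w" "rep I y w" using pos y z by metis
    with rep_unique[OF egd cons] show "\<exists>v. val_at ((a, r) # js) s = Some v \<and> val_at ((a, r) # js) t = Some v"
      by metis
  next
    fix s assume s: "s \<in> set (nils k)"
    then obtain y where y: "reach I (pos_path s) x y" "catom IsNil y \<in> I" using nils by blast
    moreover have "pos_index s \<le> length ps" using s wf' by auto
    ultimately obtain v where "val_at ((a, r) # js) s = Some v" "rep I y v" using pos by blast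
    with rep_unique[OF egd cons] rep_Nul[OF y(2)] show "val_at ((a, r) # js) s = Some Nul" by metis
  qed
  moreover have "list_all2 (\<lambda>q (a, r). ev R q a r) ps js"
    using f by (auto simp: list_all2_conv_all_nth js_def split: prod.splits) (metis fst_conv snd_conv)
  ultimately have "ev R p a r" using wf(2) by (intro ev.ev)
  with j show ?thesis unfolding derivable_at_def by blast
qed

lemma rep_chain:
  assumes "x \<in> concept_ext I (chain n)"
  shows "rep I x (num n)"
  using assms
proof (induction n arbitrary: x)
  case (Suc n)
  then show ?case by (auto intro: rep_Pr rep_Nul)
qed (auto intro: rep_Nul)

text \<open>The model agrees with the instance on closed symbols. Of the inclusion with the open
  role \<open>Look\<close>, only the existence of an element of the closed mode survives.\<close>

lemma CWA_consistent:
  assumes "J \<in> CWA (set (input_ontology n R p)) I (set closed_queries)"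
  shows "consistent I"
proof -
  have eq: "catom A x \<in> J \<longleftrightarrow> catom A x \<in> I" if "A \<in> set closed_concepts" for A x
    using assms that unfolding CWA_def closed_queries_eq_iff by blast
  have eq': "ratom e x y \<in> J \<longleftrightarrow> ratom e x y \<in> I" if "e \<in> set closed_roles" for e x y
    using assms that unfolding CWA_def closed_queries_eq_iff by blast
  have mode: "catom (Mode i) x \<in> J \<longleftrightarrow> catom (Mode i) x \<in> I" if "i \<in> set modes" for i x
    using that by (intro eq) (auto simp: closed_concepts_def)
  have other: "catom IsNil x \<in> J \<longleftrightarrow> catom IsNil x \<in> I" "catom Root x \<in> J \<longleftrightarrow> catom Root x \<in> I"
    "catom AnyMode x \<in> J \<longleftrightarrow> catom AnyMode x \<in> I" for x
    by (intro eq; simp add: closed_concepts_def)+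
  have dir: "ratom (Dir Hd) x y \<in> J \<longleftrightarrow> ratom (Dir Hd) x y \<in> I"
    "ratom (Dir Tl) x y \<in> J \<longleftrightarrow> ratom (Dir Tl) x y \<in> I" for x y
    by (intro eq'; simp add: closed_roles_def)+
  have "model J (set base_incls)"
    using assms by (simp add: CWA_def model_input_ontology_iff del: reach.simps)
  note base = this[unfolded model_base_iff other dir]
  show ?thesis
    unfolding consistent_def
  proof (intro conjI ballI allI impI)
    show "catom AnyMode x \<in> I" if "i \<in> set modes" "catom (Mode i) x \<in> I" for i x
      using conjunct1[OF base] that mode[OF that(1)] by (simp del: upt_Suc set_upt)
    show "\<exists>x. catom (Mode i) x \<in> I" if i: "i \<in> set modes" and s: "catom Root s \<in> I" for i s
    proof -
      obtain x where "catom (Mode i) x \<in> J" using bspec[OF conjunct1[OF conjunct2[OF base]] i] s by metis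
      then show ?thesis using mode[OF i] by metis
    qed
    show "i = j" if i: "i \<in> set modes" and j: "j \<in> set modes"
      and x: "catom (Mode i) x \<in> I \<and> catom (Mode j) x \<in> I" for i j x
      using bspec[OF bspec[OF conjunct1[OF conjunct2[OF conjunct2[OF base]]] i] j] x mode[OF i] mode[OF j]
      by metis
  next
    have "\<forall>x y. catom IsNil x \<in> I \<longrightarrow> ratom (Dir Hd) x y \<notin> I" using base by (elim conjE)
    then show "ratom (Dir Hd) x y \<notin> I" if "catom IsNil x \<in> I" for x y using that by metis
    have "\<forall>x y. catom IsNil x \<in> I \<longrightarrow> ratom (Dir Tl) x y \<notin> I" using base by (elim conjE)
    then show "ratom (Dir Tl) x y \<notin> I" if "catom IsNil x \<in> I" for x y using that by metis
  qed
qed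

text \<open>If all equalities hold, mode 0 is picked and all labels are read as true statements
  about values and derivations; otherwise the mode of a violated equality is picked.\<close>

lemma CWA_without_goal:
  assumes over: "over I (set signature)" and wf: "wf_rules (set R)"
    and J: "CWA (set (input_ontology n R p)) I (set closed_queries) \<noteq> {}"
    and not_ev: "\<And>r. \<not> ev (set R) p (nums [n]) r"
  shows "\<exists>J\<in>CWA (set (input_ontology n R p)) I (set closed_queries). ans J goal_query = {}"
proof -
  note [simp del] = upt_Suc reach.simps
  have cons: "consistent I" using J CWA_consistent by blast
  have no_goal: "ans (extend I k lab) goal_query = {}" if "\<And>x. \<not> lab Goal x" for k lab
    using that over_catom[OF over, of Goal] closed_concepts_not_open[of Goal]
    by (auto simp: ans_goal_query catom_extend)
  \<comment> \<open>With a root, consistency supplies the element; without one, any \<open>k\<close>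
    will do.\<close>
  have mode: "\<exists>k. \<forall>s. catom Root s \<in> I \<longrightarrow> catom (Mode m) k \<in> I" if "m \<in> set modes" for m
    using cons that by (cases "\<exists>s. catom Root s \<in> I") (auto simp: consistent_def)
  show ?thesis
  proof (cases "satisfies_egds I")
    case True
    define lab where "lab A x = (case A of IsInput \<Rightarrow> x \<in> concept_ext I (chain n) |
      IsVal \<Rightarrow> \<exists>v. rep I x v | Der q \<Rightarrow> derivable_at I (set R) q x | _ \<Rightarrow> False)" for A x
    have "0 \<in> set modes" by simp
    then obtain k where k: "\<And>s. catom Root s \<in> I \<Longrightarrow> catom (Mode 0) k \<in> I"
      using mode by blast
    have "extend I k lab \<in> CWA (set (input_ontology n R p)) I (set closed_queries)"
    proof (rule extend_CWA[OF over cons \<open>0 \<in> set modes\<close> k])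
      fix kd q ps x assume r: "(kd, q, ps) \<in> set R" "body_holds (extend I k lab) kd ps x"
      have "length ps \<le> 2" using wf r(1) unfolding wf_rules_def by blast
      note b = body_extend[OF over this r(2)]
      show "lab (Der q) x"
        unfolding lab_def csym.case
        using b by (intro derivable_at_rule[OF True cons wf r(1)]) (auto simp: lab_def)
    next
      fix x y z assume x: "lab (Der p) x" "reach I [Fld Arg, Dir Hd] x y" "lab IsInput y"
        "reach I [Fld Arg, Dir Tl] x z" "catom IsNil z \<in> I"
      obtain a r where j: "rep_judgement I x (a, r)" "ev (set R) p a r"
        using x(1) by (auto simp: lab_def derivable_at_def)
      have "\<exists>v. val_at [(a, r)] (At 0 Arg [Hd]) = Some v \<and> rep I y v"
        using rep_pos[OF True cons j(1), of "[]" _ "At 0 Arg [Hd]" y] x by simp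
      moreover have "\<exists>v. val_at [(a, r)] (At 0 Arg [Tl]) = Some v \<and> rep I z v"
        using rep_pos[OF True cons j(1), of "[]" _ "At 0 Arg [Tl]" z] x by simp
      ultimately obtain u w where a: "a = Pr u w" "rep I y u" "rep I z w" by auto
      \<comment> \<open>\<open>IsInput\<close> was placed on chains of length \<open>n\<close> only,
        so the derivation at the root is one for the forbidden argument.\<close>
      have "u = num n" "w = Nul"
        using rep_unique[OF True cons] a(2,3) rep_chain rep_Nul[OF x(5)] x(3) by (auto simp: lab_def)
      then have "a = nums [n]" using a(1) by simp
      with not_ev j(2) show "lab Goal x" by blast
    next
      show "lab IsVal x" if "catom IsNil x \<in> I" for x
        using rep_Nul[OF that] by (auto simp: lab_def)
      show "lab IsVal x" if "ratom (Dir Hd) x y \<in> I" "ratom (Dir Tl) x z \<in> I" "lab IsVal y" "lab IsVal z"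
        for x y z
        using that rep_Pr[OF that(1,2)] by (fastforce simp: lab_def)
    qed (simp_all add: lab_def)
    moreover have "ans (extend I k lab) goal_query = {}" by (rule no_goal) (simp add: lab_def)
    ultimately show ?thesis by blast
  next
    case False
    then obtain C es es' x y z where e: "(C, es, es') \<in> set egds" "x \<in> concept_ext I C"
      "reach I es x y" "reach I es' x z" "y \<noteq> z"
      unfolding satisfies_egds_def by blast
    then obtain i where i: "i < length egds" "egds ! i = (C, es, es')" by (auto simp: in_set_conv_nth)
    \<comment> \<open>The default \<open>True\<close> satisfies all Horn inclusions for other open
      labels at once. \<open>Goal\<close> can stay empty because the mode is not 0 and the two marks
      sit on distinct elements.\<close>
    define lab where "lab A x = (case A of LeftEnd \<Rightarrow> x = y | RightEnd \<Rightarrow> x = z | Goal \<Rightarrow> False | _ \<Rightarrow> True)"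
      for A x
    have m: "Suc i \<in> set modes" using i by simp
    then obtain k where k: "\<And>s. catom Root s \<in> I \<Longrightarrow> catom (Mode (Suc i)) k \<in> I"
      using mode by blast
    have "extend I k lab \<in> CWA (set (input_ontology n R p)) I (set closed_queries)"
      by (rule extend_CWA[OF over cons m k]) (use e i in \<open>auto simp: lab_def\<close>)
    moreover have "ans (extend I k lab) goal_query = {}" by (rule no_goal) (simp add: lab_def)
    ultimately show ?thesis by blast
  qed
qed

section \<open>Instances obtained from derivation trees\<close>

datatype tree = Node kind prog judgement "tree list"

instance tree :: countable by countable_datatype

primrec jdg :: "tree \<Rightarrow> judgement" where
  "jdg (Node k p j ts) = j"

primrec prog_of :: "tree \<Rightarrow> prog" where
  "prog_of (Node k p j ts) = p"

text \<open>Quantifying over the mapped list keeps the nested recursion primitive.\<close>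

primrec valid :: "rule set \<Rightarrow> tree \<Rightarrow> bool" where
  "valid R (Node k p j ts) \<longleftrightarrow> (k, p, map prog_of ts) \<in> R \<and> holds k (j # map jdg ts) \<and>
     (\<forall>b\<in>set (map (valid R) ts). b)"

lemma ev_tree: "ev R p a r \<Longrightarrow> \<exists>t. valid R t \<and> prog_of t = p \<and> jdg t = (a, r)"
proof (induction rule: ev.induct)
  case (ev k p ps js a r)
  have "\<exists>t. valid R t \<and> prog_of t = ps ! i \<and> jdg t = js ! i" if "i < length ps" for i
    using ev(3) that by (auto simp: list_all2_conv_all_nth split: prod.splits) (metis prod.collapse)
  then obtain f where f: "\<And>i. i < length ps \<Longrightarrow> valid R (f i) \<and> prog_of (f i) = ps ! i \<and> jdg (f i) = js ! i"
    by metis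
  have len: "length js = length ps" using ev(3) by (simp add: list_all2_lengthD)
  define ts where "ts = map f [0..<length ps]"
  have "map prog_of ts = ps" "map jdg ts = js"
    using f len by (auto simp: ts_def intro: nth_equalityI)
  moreover have "\<forall>t\<in>set ts. valid R t" using f by (auto simp: ts_def)
  ultimately have "valid R (Node k p (a, r) ts)" using ev(1,2) by auto
  then show ?case by (intro exI[of _ "Node k p (a, r) ts"]) simp
qed

text \<open>Elements are the values and subtrees themselves, so equal values are one and the same
  element. This turns the equations between values into coinciding path ends.\<close>

datatype elem = VElem val | TElem tree | MElem nat

instance elem :: countable by countable_datatype

fun step :: "rsym \<Rightarrow> elem \<Rightarrow> elem option" where
  "step (Fld fl) (TElem (Node k p j ts)) = Some (VElem (field_val fl j))"
| "step (Premise i) (TElem (Node k p j ts)) = (if i < length ts then Some (TElem (ts ! i)) else None)"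
| "step (Dir Hd) (VElem (Pr u w)) = Some (VElem u)"
| "step (Dir Tl) (VElem (Pr u w)) = Some (VElem w)"
| "step e x = None"

primrec walk :: "rsym list \<Rightarrow> elem \<Rightarrow> elem option" where
  "walk [] x = Some x"
| "walk (e # es) x = Option.bind (step e x) (walk es)"

primrec subvals :: "val \<Rightarrow> val set" where
  "subvals Nul = {Nul}"
| "subvals (Pr u w) = insert (Pr u w) (subvals u \<union> subvals w)"

primrec parts :: "tree \<Rightarrow> elem set" where
  "parts (Node k p j ts) = insert (TElem (Node k p j ts))
     (VElem ` (subvals (fst j) \<union> subvals (snd j)) \<union> \<Union> (set (map parts ts)))"

lemma finite_subvals: "finite (subvals v)"
  by (induction v) auto

lemma finite_parts: "finite (parts t)"
  by (induction t) (auto simp: finite_subvals)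

lemma subvals_refl: "v \<in> subvals v"
  by (cases v) auto

lemma parts_refl: "TElem t \<in> parts t"
  by (cases t) auto

lemma subvals_Pr: "Pr u w \<in> subvals v \<Longrightarrow> u \<in> subvals v \<and> w \<in> subvals v"
  by (induction v) (auto simp: subvals_refl)

lemma parts_step: "x \<in> parts t \<Longrightarrow> step e x = Some y \<Longrightarrow> y \<in> parts t"
proof (induction t)
  case (Node k p j ts)
  show ?case
  proof (cases "x \<in> \<Union> (set (map parts ts))")
    case True
    then obtain t where t: "t \<in> set ts" "x \<in> parts t" by auto
    with Node.IH[OF t] Node.prems(2) show ?thesis by auto
  next
    case False
    with Node.prems(1) consider "x = TElem (Node k p j ts)"
      | v where "x = VElem v" "v \<in> subvals (fst j) \<union> subvals (snd j)" by auto
    then show ?thesis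
    proof cases
      case 1
      have "field_val fl j \<in> subvals (fst j) \<union> subvals (snd j)" for fl
        by (cases fl) (auto simp: subvals_refl)
      with 1 Node.prems(2) show ?thesis
        by (cases e) (auto simp: parts_refl split: if_splits intro!: bexI[OF _ nth_mem])
    next
      case 2
      with Node.prems(2) obtain d u w where "e = Dir d" "v = Pr u w"
        by (cases e; cases v) auto
      with 2 Node.prems(2) show ?thesis by (cases d) (auto dest!: subvals_Pr)
    qed
  qed
qed

lemma parts_valid: "valid R t \<Longrightarrow> TElem s \<in> parts t \<Longrightarrow> valid R s"
  by (induction t) auto

lemma walk_vals: "walk (map Dir ds) (VElem v) = map_option VElem (sel ds v)"
proof (induction ds arbitrary: v)
  case (Cons d ds)
  then show ?case by (cases d; cases v) auto
qed simp

lemma walk_pos: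
  assumes "pos_index s \<le> length ts"
  shows "walk (pos_path s) (TElem (Node k p j ts)) = map_option VElem (val_at (j # map jdg ts) s)"
proof (cases s)
  case (At i fl ds)
  have *: "walk (Fld fl # map Dir ds) (TElem t) = map_option VElem (sel ds (field_val fl (jdg t)))" for t
    by (cases t) (simp add: walk_vals)
  show ?thesis
    using assms *[of "Node k p j ts"] *[of "ts ! (i - 1)"] by (cases i) (auto simp: At)
qed

text \<open>Edges follow the partial function \<open>step\<close>, hence are functional. One element
  is supplied for each mode, so every choice of mode is open to a model.\<close>

definition tree_inst :: "tree \<Rightarrow> inst" where
  "tree_inst t =
     {ratom e (to_nat x) (to_nat y) | e x y. e \<in> set closed_roles \<and> x \<in> parts t \<and> step e x = Some y} \<union>
     {catom (Kind k) (to_nat (TElem (Node k p j ts))) | k p j ts. TElem (Node k p j ts) \<in> parts t} \<union>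
     {catom IsNil (to_nat (VElem Nul)), catom Root (to_nat (TElem t))} \<union>
     {catom A (to_nat (MElem i)) | A i. i \<in> set modes \<and> A \<in> {Mode i, AnyMode}}"

lemma ratom_tree_inst:
  "ratom e x y \<in> tree_inst t \<longleftrightarrow> e \<in> set closed_roles \<and>
     (\<exists>u v. u \<in> parts t \<and> x = to_nat u \<and> step e u = Some v \<and> y = to_nat v)"
  by (auto simp: tree_inst_def)

lemma catom_tree_inst:
  "catom (Kind k) x \<in> tree_inst t \<longleftrightarrow>
     (\<exists>p j ts. x = to_nat (TElem (Node k p j ts)) \<and> TElem (Node k p j ts) \<in> parts t)"
  "catom IsNil x \<in> tree_inst t \<longleftrightarrow> x = to_nat (VElem Nul)"
  "catom Root x \<in> tree_inst t \<longleftrightarrow> x = to_nat (TElem t)"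
  "catom AnyMode x \<in> tree_inst t \<longleftrightarrow> (\<exists>i\<in>set modes. x = to_nat (MElem i))"
  "catom (Mode i) x \<in> tree_inst t \<longleftrightarrow> i \<in> set modes \<and> x = to_nat (MElem i)"
  unfolding tree_inst_def by (auto simp del: upt_Suc)

lemma finite_tree_inst: "finite (tree_inst t)"
proof -
  have "{catom (Kind k) (to_nat (TElem (Node k p j ts))) | k p j ts. TElem (Node k p j ts) \<in> parts t}
      \<subseteq> (\<lambda>(k, x). catom (Kind k) (to_nat x)) ` (set kinds \<times> parts t)"
    by auto
  then have kinds: "finite {catom (Kind k) (to_nat (TElem (Node k p j ts))) | k p j ts.
      TElem (Node k p j ts) \<in> parts t}"
    by (rule finite_subset) (intro finite_imageI finite_cartesian_product List.finite_set finite_parts)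
  have "{ratom e (to_nat x) (to_nat y) | e x y. e \<in> set closed_roles \<and> x \<in> parts t \<and> step e x = Some y}
      \<subseteq> (\<lambda>(e, x). ratom e (to_nat x) (to_nat (the (step e x)))) ` (set closed_roles \<times> parts t)"
    by force
  then have roles: "finite {ratom e (to_nat x) (to_nat y) | e x y.
      e \<in> set closed_roles \<and> x \<in> parts t \<and> step e x = Some y}"
    by (rule finite_subset) (simp add: finite_parts)
  have "{catom A (to_nat (MElem i)) | A i. i \<in> set modes \<and> A \<in> {Mode i, AnyMode}}
      \<subseteq> (\<lambda>i. catom (Mode i) (to_nat (MElem i))) ` set modes \<union>
        (\<lambda>i. catom AnyMode (to_nat (MElem i))) ` set modes"
    by auto
  then have "finite {catom A (to_nat (MElem i)) | A i. i \<in> set modes \<and> A \<in> {Mode i, AnyMode}}"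
    by (rule finite_subset) simp
  with kinds roles show ?thesis unfolding tree_inst_def by simp
qed

lemma over_tree_inst: "over (tree_inst t) (set signature)"
proof -
  have "Kind k \<in> set closed_concepts" "IsNil \<in> set closed_concepts" "Root \<in> set closed_concepts"
    "AnyMode \<in> set closed_concepts" "i \<in> set modes \<Longrightarrow> Mode i \<in> set closed_concepts" for k i
    by (simp_all add: closed_concepts_def del: upt_Suc)
  then show ?thesis
    unfolding over_def signature_def tree_inst_def by (auto simp del: upt_Suc)
qed

lemma consistent_tree_inst: "consistent (tree_inst t)"
  unfolding consistent_def catom_tree_inst ratom_tree_inst by (auto simp del: upt_Suc)

lemma reach_tree_inst:
  "u \<in> parts t \<Longrightarrow> set es \<subseteq> set closed_roles \<Longrightarrow>
     reach (tree_inst t) es (to_nat u) y \<longleftrightarrow> (\<exists>v. walk es u = Some v \<and> y = to_nat v)"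
proof (induction es arbitrary: u)
  case (Cons e es)
  have "reach (tree_inst t) (e # es) (to_nat u) y \<longleftrightarrow>
      (\<exists>v. step e u = Some v \<and> reach (tree_inst t) es (to_nat v) y)"
    using Cons.prems by (auto simp: ratom_tree_inst)
  also have "\<dots> \<longleftrightarrow> (\<exists>v w. step e u = Some v \<and> walk es v = Some w \<and> y = to_nat w)"
    using Cons.IH[OF parts_step[OF Cons.prems(1)]] Cons.prems(2) by auto
  finally show ?case by (auto simp: bind_eq_Some_conv)
qed auto

lemma satisfies_egds_tree_inst:
  assumes "valid R t" "wf_rules R"
  shows "satisfies_egds (tree_inst t)"
  unfolding satisfies_egds_def
proof clarify
  fix C es es' x y z
  assume e: "(C, es, es') \<in> set egds" and x: "x \<in> concept_ext (tree_inst t) C"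
    and y: "reach (tree_inst t) es x y" and z: "reach (tree_inst t) es' x z"
  from e consider e where "es = [e]" "es' = [e]"
    | k s s' where "C = \<langle>Kind k\<rangle>" "es = pos_path s" "es' = pos_path s'" "(s, s') \<in> set (eqs k)"
    unfolding set_egds by blast
  then show "y = z"
  proof cases
    case 1
    then show ?thesis using y z by (auto simp: ratom_tree_inst)
  next
    case 2
    then obtain p j ts where n: "x = to_nat (TElem (Node k p j ts))" "TElem (Node k p j ts) \<in> parts t"
      using x by (auto simp: catom_tree_inst)
    then have v: "valid R (Node k p j ts)" using parts_valid assms(1) by blast
    then have "(k, p, map prog_of ts) \<in> R" by simp
    then have idx: "pos_index s \<le> length ts" "pos_index s' \<le> length ts"
      using assms(2) 2(4) unfolding wf_rules_def by fastforce+
    have "val_at (j # map jdg ts) s = val_at (j # map jdg ts) s'"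
      using v 2(4) by (auto simp: holds_def)
    then have "walk es (TElem (Node k p j ts)) = walk es' (TElem (Node k p j ts))"
      unfolding 2(2,3) using walk_pos idx by metis
    then show ?thesis
      using y z reach_tree_inst[OF n(2)] egds_closed[OF e] unfolding n(1) by auto
  qed
qed

lemma reach_cong:
  "(\<And>e x y. e \<in> set es \<Longrightarrow> ratom e x y \<in> J \<longleftrightarrow> ratom e x y \<in> I) \<Longrightarrow> reach J es x y \<longleftrightarrow> reach I es x y"
  by (induction es arbitrary: x) auto

lemma chain_tree_inst:
  "VElem (num n) \<in> parts t \<Longrightarrow> to_nat (VElem (num n)) \<in> concept_ext (tree_inst t) (chain n)"
proof (induction n)
  case (Suc n)
  have "VElem Nul \<in> parts t" "VElem (num n) \<in> parts t"
    using parts_step[OF Suc.prems, of "Dir Hd"] parts_step[OF Suc.prems, of "Dir Tl"] by auto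
  with Suc show ?case by (force simp: catom_tree_inst ratom_tree_inst closed_roles_def)
qed (simp add: catom_tree_inst)

lemma chain_cong:
  assumes "\<And>x. catom IsNil x \<in> J \<longleftrightarrow> catom IsNil x \<in> I"
    and "\<And>d x y. ratom (Dir d) x y \<in> J \<longleftrightarrow> ratom (Dir d) x y \<in> I"
  shows "concept_ext J (chain n) = concept_ext I (chain n)"
  by (induction n) (auto simp: assms)

text \<open>Whatever mode the root picks, \<open>Goal\<close> follows: a claimed violation must put
  both marks on the same element, and in mode 0 the labels propagate up the tree to the
  root.\<close>

lemma goal_tree_inst:
  assumes t: "valid (set R) t" "wf_rules (set R)" "prog_of t = p" "fst (jdg t) = nums [n]"
    and J: "J \<in> CWA (set (input_ontology n R p)) (tree_inst t) (set closed_queries)"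
  shows "\<exists>x. catom Goal x \<in> J"
proof -
  note [simp del] = upt_Suc reach.simps
  let ?I = "tree_inst t"
  have eq: "catom A x \<in> J \<longleftrightarrow> catom A x \<in> ?I" if "A \<in> set closed_concepts" for A x
    using J that unfolding CWA_def closed_queries_eq_iff by blast
  have Mode: "catom (Mode i) x \<in> J \<longleftrightarrow> catom (Mode i) x \<in> ?I" if "i \<in> set modes" for i x
    using that by (intro eq) (auto simp: closed_concepts_def)
  have closed: "catom (Kind k) x \<in> J \<longleftrightarrow> catom (Kind k) x \<in> ?I" "catom IsNil x \<in> J \<longleftrightarrow> catom IsNil x \<in> ?I"
    "catom Root x \<in> J \<longleftrightarrow> catom Root x \<in> ?I" "catom AnyMode x \<in> J \<longleftrightarrow> catom AnyMode x \<in> ?I" for k x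
    by (intro eq; simp add: closed_concepts_def)+
  have role: "ratom e x y \<in> J \<longleftrightarrow> ratom e x y \<in> ?I" if "e \<in> set closed_roles" for e x y
    using J that unfolding CWA_def closed_queries_eq_iff by blast
  have edge: "ratom e (to_nat u) (to_nat v) \<in> J"
    if "e \<in> set closed_roles" "u \<in> parts t" "step e u = Some v" for e u v
    using that role by (auto simp: ratom_tree_inst)
  have reach: "reach J es x y \<longleftrightarrow> reach ?I es x y" if "set es \<subseteq> set closed_roles" for es x y
    by (rule reach_cong) (use role that in blast)
  have closed_roles: "Fld fl \<in> set closed_roles" "Dir d \<in> set closed_roles"
    "i < 2 \<Longrightarrow> Premise i \<in> set closed_roles" for fl d i
    by (cases fl; cases d; auto simp: closed_roles_def)+
  have "model J (set (input_ontology n R p))" using J by (simp add: CWA_def)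
  note m = this[unfolded model_input_ontology_iff model_base_iff]
  have inp: "concept_ext J (chain n) \<subseteq> {x. catom IsInput x \<in> J}" using m by (elim conjE)
  have goal: "\<forall>x k y z. catom Root x \<in> J \<and> ratom Pick x k \<in> J \<and> catom (Mode 0) k \<in> J \<and> catom (Der p) x \<in> J \<and>
        reach J [Fld Arg, Dir Hd] x y \<and> catom IsInput y \<in> J \<and>
        reach J [Fld Arg, Dir Tl] x z \<and> catom IsNil z \<in> J \<longrightarrow> catom Goal x \<in> J" using m by (elim conjE)
  have rules: "\<forall>(k, q, ps)\<in>set R. \<forall>x. body_holds J k ps x \<longrightarrow> catom (Der q) x \<in> J" using m by (elim conjE)
  have egd: "\<forall>i<length egds. case egds ! i of (C, es, es') \<Rightarrow>
        (\<forall>s k. ratom Pick s k \<in> J \<and> catom (Mode (Suc i)) k \<in> J \<longrightarrow>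
          (\<exists>x y z. ratom Look s x \<in> J \<and> x \<in> concept_ext J C \<and>
            reach J es x y \<and> catom LeftEnd y \<in> J \<and> reach J es' x z \<and> catom RightEnd z \<in> J))"
    using m by (elim conjE)
  have pick: "\<forall>s. catom Root s \<in> J \<longrightarrow> (\<exists>k. ratom Pick s k \<in> J \<and> catom AnyMode k \<in> J)" using m by (elim conjE)
  have ends: "\<forall>x. catom LeftEnd x \<in> J \<and> catom RightEnd x \<in> J \<longrightarrow> catom Goal x \<in> J" using m by (elim conjE)
  have nil: "\<forall>x. catom IsNil x \<in> J \<longrightarrow> catom IsVal x \<in> J" using m by (elim conjE)
  have pair: "\<forall>x y z. ratom (Dir Hd) x y \<in> J \<and> catom IsVal y \<in> J \<and> ratom (Dir Tl) x z \<in> J \<and>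
        catom IsVal z \<in> J \<longrightarrow> catom IsVal x \<in> J" using m by (elim conjE)
  have root: "catom Root (to_nat (TElem t)) \<in> J" by (simp add: closed catom_tree_inst)
  then obtain k where k: "ratom Pick (to_nat (TElem t)) k \<in> J" "catom AnyMode k \<in> J" using pick by blast
  \<comment> \<open>\<open>AnyMode\<close> is closed, so the model cannot pick a fresh
    element.\<close>
  then obtain i where i: "i \<in> set modes" "k = to_nat (MElem i)" by (auto simp: closed catom_tree_inst)
  then have mode: "catom (Mode i) k \<in> J" by (simp add: Mode catom_tree_inst)
  show ?thesis
  proof (cases i)
    case (Suc i')
    obtain C es es' where e: "egds ! i' = (C, es, es')" by (cases "egds ! i'")
    have len: "i' < length egds" using i Suc by simp
    then have mem: "(C, es, es') \<in> set egds" using e by (metis nth_mem)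
    obtain x y z where xyz: "x \<in> concept_ext J C" "reach J es x y" "catom LeftEnd y \<in> J"
        "reach J es' x z" "catom RightEnd z \<in> J"
      using egd[rule_format, OF len] k(1) mode unfolding e Suc by auto
    have r: "reach ?I es x y" "reach ?I es' x z"
      using xyz(2,4) reach egds_closed[OF mem] by auto
    \<comment> \<open>The model may have more elements than the instance. For \<open>Top\<close>,
      \<open>x\<close> is an old element since it has an outgoing closed edge; otherwise
      \<open>C\<close> is a closed concept name.\<close>
    moreover have "x \<in> concept_ext ?I C"
    proof -
      from mem consider e where "C = Top" "es = [e]"
        | kd where "C = \<langle>Kind kd\<rangle>" unfolding set_egds by blast
      then show ?thesis
      proof cases
        case 1
        with r(1) show ?thesis by (auto simp: reach.simps dest: ratom_adom)
      next
        case 2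
        with xyz(1) show ?thesis by (simp add: closed)
      qed
    qed
    ultimately have "y = z"
      using satisfies_egds_tree_inst[OF t(1,2)] mem unfolding satisfies_egds_def by blast
    with xyz(3,5) ends show ?thesis by blast
  next
    case 0
    have val: "catom IsVal (to_nat (VElem v)) \<in> J" if "VElem v \<in> parts t" for v
      using that
    proof (induction v)
      case Nul
      then show ?case using nil by (simp add: closed catom_tree_inst)
    next
      case (Pr u w)
      have "ratom (Dir Hd) (to_nat (VElem (Pr u w))) (to_nat (VElem u)) \<in> J"
        "ratom (Dir Tl) (to_nat (VElem (Pr u w))) (to_nat (VElem w)) \<in> J"
        using Pr.prems edge closed_roles by auto
      moreover have "VElem u \<in> parts t" "VElem w \<in> parts t"
        using parts_step[OF Pr.prems, of "Dir Hd"] parts_step[OF Pr.prems, of "Dir Tl"] by auto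
      ultimately show ?case using Pr.IH pair by blast
    qed
    have der: "catom (Der (prog_of s)) (to_nat (TElem s)) \<in> J" if "TElem s \<in> parts t" for s
      using that
    proof (induction s)
      case (Node kd q j ts)
      let ?x = "to_nat (TElem (Node kd q j ts))"
      note mem = Node.prems
      have v: "valid (set R) (Node kd q j ts)" using parts_valid t(1) mem by blast
      have r: "(kd, q, map prog_of ts) \<in> set R" using v by simp
      then have wf: "length ts \<le> 2" "\<And>s s'. (s, s') \<in> set (eqs kd) \<Longrightarrow> pos_index s \<le> length ts \<and> pos_index s' \<le> length ts"
        "\<And>s. s \<in> set (nils kd) \<Longrightarrow> pos_index s \<le> length ts"
        using t(2) unfolding wf_rules_def by fastforce+
      have h: "holds kd (j # map jdg ts)" using v by simp
      have at: "reach J (pos_path s) ?x (to_nat (VElem w))"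
        if "pos_index s \<le> length ts" "val_at (j # map jdg ts) s = Some w" for s w
      proof -
        have c: "set (pos_path s) \<subseteq> set closed_roles" using that(1) wf(1) by (intro pos_path_closed) simp
        show ?thesis using that walk_pos[OF that(1)] unfolding reach[OF c] reach_tree_inst[OF mem c] by auto
      qed
      have "body_holds J kd (map prog_of ts) ?x"
        unfolding body_holds_def
      proof (intro conjI allI impI ballI)
        show "catom (Kind kd) ?x \<in> J" using mem by (auto simp: closed catom_tree_inst)
        show "\<exists>y. ratom (Fld fl) ?x y \<in> J \<and> catom IsVal y \<in> J" for fl
        proof -
          have "step (Fld fl) (TElem (Node kd q j ts)) = Some (VElem (field_val fl j))" by simp
          then show ?thesis using edge[OF closed_roles(1) mem] val parts_step[OF mem] by blast
        qed
        show "\<exists>y. ratom (Premise l) ?x y \<in> J \<and> catom (Der (map prog_of ts ! l)) y \<in> J"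
          if l: "l < length (map prog_of ts)" for l
        proof -
          have s: "step (Premise l) (TElem (Node kd q j ts)) = Some (TElem (ts ! l))" using l by simp
          have "catom (Der (prog_of (ts ! l))) (to_nat (TElem (ts ! l))) \<in> J"
            using l parts_step[OF mem s] by (intro Node.IH) auto
          moreover have "Premise l \<in> set closed_roles" using l wf(1) closed_roles(3) by simp
          ultimately show ?thesis using edge[OF _ mem s] l by auto
        qed
        show "case x of (s, s') \<Rightarrow> (\<exists>y. reach J (pos_path s) ?x y) \<and> (\<exists>y. reach J (pos_path s') ?x y)"
          if x_eq: "x \<in> set (eqs kd)" for x
        proof -
          obtain s s' where x: "x = (s, s')" by (cases x)
          obtain w where "val_at (j # map jdg ts) s = Some w" "val_at (j # map jdg ts) s' = Some w"
            using bspec[OF conjunct1[OF h[unfolded holds_iff]] x_eq] unfolding x by auto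
          then show ?thesis using at wf(2)[OF x_eq[unfolded x]] unfolding x by fast
        qed
        show "\<exists>y. reach J (pos_path s) ?x y \<and> catom IsNil y \<in> J" if "s \<in> set (nils kd)" for s
        proof -
          have "val_at (j # map jdg ts) s = Some Nul" using h that unfolding holds_iff by blast
          then have "reach J (pos_path s) ?x (to_nat (VElem Nul))" using at wf(3)[OF that] by metis
          moreover have "catom IsNil (to_nat (VElem Nul)) \<in> J" by (simp add: closed catom_tree_inst)
          ultimately show ?thesis by metis
        qed
      qed
      then show ?case using bspec[OF rules r] by simp
    qed
    let ?x = "to_nat (TElem t)"
    have arg: "reach ?I [Fld Arg, Dir Hd] ?x (to_nat (VElem (num n)))"
      "reach ?I [Fld Arg, Dir Tl] ?x (to_nat (VElem Nul))"
      using closed_roles t(4) by (cases t; simp add: reach_tree_inst[OF parts_refl])+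
    obtain a where a: "step (Fld Arg) (TElem t) = Some (VElem (nums [n]))"
      using t(4) by (cases t) auto
    have "VElem (num n) \<in> parts t"
      using parts_step[OF parts_step[OF parts_refl a], of "Dir Hd"] by simp
    then have "to_nat (VElem (num n)) \<in> concept_ext J (chain n)"
      using chain_tree_inst chain_cong[of J ?I n, OF closed(2) role[OF closed_roles(2)]] by simp
    then have "catom IsInput (to_nat (VElem (num n))) \<in> J" using inp by blast
    moreover have "reach J [Fld Arg, Dir Hd] ?x (to_nat (VElem (num n)))"
      "reach J [Fld Arg, Dir Tl] ?x (to_nat (VElem Nul))"
      using arg reach closed_roles by simp_all
    moreover have "catom (Der p) ?x \<in> J" using der[OF parts_refl] t(3) by simp
    moreover have "catom IsNil (to_nat (VElem Nul)) \<in> J" by (simp add: closed catom_tree_inst)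
    moreover have "catom (Mode 0) k \<in> J" using mode 0 by simp
    ultimately have "catom Goal ?x \<in> J" using goal root k(1) by metis
    then show ?thesis ..
  qed
qed

lemma nullable_input_ontology_iff:
  assumes "wf_rules (set R)"
  shows "nullable (input_ontology n R p, signature, closed_queries, goal_query) \<longleftrightarrow>
     (\<nexists>r. ev (set R) p (nums [n]) r)"
proof
  assume "\<nexists>r. ev (set R) p (nums [n]) r"
  then show "nullable (input_ontology n R p, signature, closed_queries, goal_query)"
    using CWA_without_goal[OF _ assms] by simp
next
  assume null: "nullable (input_ontology n R p, signature, closed_queries, goal_query)"
  show "\<nexists>r. ev (set R) p (nums [n]) r"
  proof
    assume "\<exists>r. ev (set R) p (nums [n]) r"
    then obtain t where t: "valid (set R) t" "prog_of t = p" "fst (jdg t) = nums [n]"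
      using ev_tree by fastforce
    let ?I = "tree_inst t"
    \<comment> \<open>Making all open labels true, \<open>Goal\<close> included, gives a model, so
      the tree instance is consistent and nullability applies to it.\<close>
    have "extend ?I (to_nat (MElem 0)) (\<lambda>_ _. True) \<in>
        CWA (set (input_ontology n R p)) ?I (set closed_queries)"
      by (rule extend_CWA[OF over_tree_inst consistent_tree_inst, of 0])
        (simp_all add: catom_tree_inst)
    then obtain J where "J \<in> CWA (set (input_ontology n R p)) ?I (set closed_queries)"
      "ans J goal_query = {}"
      using null finite_tree_inst over_tree_inst unfolding nullable.simps by blast
    then show False
      using goal_tree_inst[OF t(1) assms t(2,3)] unfolding ans_goal_query by fast
  qed
qed

section \<open>The diagonal argument\<close>

lemma computes_Comp1: "computes g xs y \<Longrightarrow> computes f [y] z \<Longrightarrow> computes (Comp f [g]) xs z"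
  by (rule computes.Comp) auto

lemma computes_Comp2:
  "computes g xs y \<Longrightarrow> computes h xs z \<Longrightarrow> computes f [y, z] w \<Longrightarrow> computes (Comp f [g, h]) xs w"
  by (rule computes.Comp) auto

lemma computes_Proj: "i < length xs \<Longrightarrow> xs ! i = y \<Longrightarrow> computes (Proj i) xs y"
  using computes.Proj by blast

primrec const_recf :: "nat \<Rightarrow> recf" where
  "const_recf 0 = Zero"
| "const_recf (Suc n) = Comp Succ [const_recf n]"

lemma computes_const: "computes (const_recf n) xs n"
  by (induction n) (auto intro: computes.Zero computes.Succ computes_Comp1)

definition add_recf :: recf where
  "add_recf = PRec (Proj 0) (Comp Succ [Proj 1])"

lemma computes_add: "computes add_recf [m, n] (m + n)"
  unfolding add_recf_def
proof (induction m)
  case 0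
  show ?case by (intro computes.PRec_0 computes_Proj) auto
next
  case (Suc m)
  have "computes (Comp Succ [Proj 1]) [m, m + n, n] (Suc m + n)"
    by (intro computes_Comp1[of _ _ "m + n"] computes_Proj) (auto intro: computes.Succ)
  with Suc show ?case by (rule computes.PRec_Suc)
qed

definition triangle_recf :: recf where
  "triangle_recf = PRec Zero (Comp Succ [Comp add_recf [Proj 0, Proj 1]])"

lemma computes_triangle: "computes triangle_recf [n] (triangle n)"
  unfolding triangle_recf_def
proof (induction n)
  case 0
  show ?case using computes.PRec_0[OF computes.Zero] by simp
next
  case (Suc n)
  have "computes (Comp add_recf [Proj 0, Proj 1]) [n, triangle n] (n + triangle n)"
    by (intro computes_Comp2[OF computes_Proj computes_Proj computes_add]) auto
  from computes_Comp1[OF this computes.Succ]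
  have "computes (Comp Succ [Comp add_recf [Proj 0, Proj 1]]) [n, triangle n] (triangle (Suc n))"
    by (simp add: add.commute)
  with Suc show ?case by (rule computes.PRec_Suc)
qed

text \<open>Cantor pairing: \<open>prod_encode (m, n)\<close> is
  \<open>triangle (m + n) + m\<close>.\<close>

definition pair_recf :: "recf \<Rightarrow> recf \<Rightarrow> recf" where
  "pair_recf f g = Comp (Comp add_recf [Comp triangle_recf [add_recf], Proj 0]) [f, g]"

lemma computes_pair:
  assumes "computes f xs m" "computes g xs n"
  shows "computes (pair_recf f g) xs (prod_encode (m, n))"
proof -
  have "computes (Comp add_recf [Comp triangle_recf [add_recf], Proj 0]) [m, n] (triangle (m + n) + m)"
    by (rule computes_Comp2[OF computes_Comp1[OF computes_add computes_triangle] computes_Proj computes_add])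
      auto
  with assms show ?thesis
    unfolding pair_recf_def by (auto simp: prod_encode_def intro: computes_Comp2)
qed

text \<open>The constants 3 and 4 are the tags of \<open>Conj\<close> and \<open>Ex\<close> in
  \<open>concept_code\<close>; \<open>Proj 1\<close> is the code already computed for the shorter
  chain.\<close>

definition chain_recf :: recf where
  "chain_recf = PRec (const_recf (concept_code (chain 0)))
     (pair_recf (const_recf 3) (pair_recf (const_recf (concept_code (along [Dir Hd] \<langle>IsNil\<rangle>)))
       (pair_recf (const_recf 4) (pair_recf (const_recf (role_code (Role (to_nat (Dir Tl))))) (Proj 1)))))"

lemma computes_chain: "computes chain_recf [n] (concept_code (chain n))"
  unfolding chain_recf_def
proof (induction n)
  case 0
  show ?case by (intro computes.PRec_0 computes_const)
next
  case (Suc n)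
  from Suc show ?case
    by (rule computes.PRec_Suc)
      (simp only: chain.simps along.simps concept_code.simps(4,5),
        intro computes_pair computes_const computes_Proj, auto)
qed

text \<open>On the code of an ontology that simulates a program, this returns the code of the nullability
  input for that program running on the very same code.\<close>

definition input_recf :: "query \<Rightarrow> recf" where
  "input_recf q = pair_recf
     (Comp Succ [pair_recf (pair_recf chain_recf (const_recf (concept_code \<langle>IsInput\<rangle>))) (Proj 0)])
     (const_recf (prod_encode (list_encode (map symbol_code signature),
       prod_encode (list_encode (map query_code closed_queries), query_code q))))"

text \<open>Here \<open>n\<close> plays two roles: as a number it determines the chain concept, as a
  code it is the tail of the list of inclusions. The outer \<open>Succ\<close> comes from
  \<open>list_encode\<close>, which codes a nonempty list as the successor of a pair.\<close>

lemma computes_input: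
  assumes "n = list_encode (map inclusion_code (program_ontology R p))"
  shows "computes (input_recf q) [n] (input_code (input_ontology n R p, signature, closed_queries, q))"
proof -
  have "computes (input_recf q) [n]
    (prod_encode (Suc (prod_encode (prod_encode (concept_code (chain n), concept_code \<langle>IsInput\<rangle>), n)),
      prod_encode (list_encode (map symbol_code signature),
        prod_encode (list_encode (map query_code closed_queries), query_code q))))"
    unfolding input_recf_def
    by (intro computes_pair computes_const computes_Comp1[OF computes_pair computes.Succ]
        computes_chain computes_Proj) auto
  then show ?thesis using assms by (simp add: input_ontology_def del: concept_code.simps)
qed

definition is_zero_recf :: recf where
  "is_zero_recf = PRec (const_recf 1) Zero"

lemma computes_is_zero:
  "computes is_zero_recf [0] 1"
  "computes is_zero_recf [1] 0"
proof -
  show *: "computes is_zero_recf [0] 1"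
    unfolding is_zero_recf_def by (intro computes.PRec_0 computes_const)
  show "computes is_zero_recf [1] 0"
    using computes.PRec_Suc[OF *[unfolded is_zero_recf_def] computes.Zero]
    by (simp add: is_zero_recf_def)
qed

text \<open>\<open>Proj 1\<close> skips the search variable, so the searched function is constant in
  it: the search stops at 0 if \<open>f\<close> answers 1 on the constructed input, and never if
  \<open>f\<close> answers 0.\<close>

definition diagonal_recf :: "query \<Rightarrow> recf \<Rightarrow> recf" where
  "diagonal_recf q f = Mu (Comp is_zero_recf [Comp f [Comp (input_recf q) [Proj 1]]])"

lemma ex_computes_iff_ev:
  "(\<exists>y. computes f xs y) \<longleftrightarrow> (\<exists>r. ev (set (rules_of f)) (Fun f) (nums xs) r)"
proof
  assume "\<exists>r. ev (set (rules_of f)) (Fun f) (nums xs) r"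
  then obtain r where "ev recf_rules (Fun f) (nums xs) r" using rules_of_subset ev_mono by blast
  from ev_computes[OF this] show "\<exists>y. computes f xs y" by auto
qed (auto dest: computes_ev)

lemma wf_rules_of: "wf_rules (set (rules_of f))"
  using rules_of_subset[of f] recf_rules_wf unfolding wf_rules_def by fast

lemma nullability_inputs_input_ontology:
  assumes "q \<in> Q"
  shows "(input_ontology n R p, signature, closed_queries, q) \<in> nullability_inputs ELI_bot AQ Q"
  using assms by (auto simp: nullability_inputs_def ELI_bot_def closed_queries_def AQ_def IQ_def)

lemma nullable_cong:
  "(\<And>J. ans J q = {} \<longleftrightarrow> ans J q' = {}) \<Longrightarrow> nullable (\<phi>, \<Sigma>, Q, q) \<longleftrightarrow> nullable (\<phi>, \<Sigma>, Q, q')"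
  by simp

text \<open>The reduction makes \<open>x\<close> nullable iff \<open>g\<close> diverges on
  \<open>n\<close>, while \<open>g\<close> was built to halt on \<open>n\<close> iff the supposed
  procedure accepts \<open>x\<close>. There is no circularity: \<open>g\<close> depends only on
  \<open>q\<close> and \<open>f\<close>, and \<open>n\<close> on \<open>g\<close>.\<close>

lemma nullability_undecidable:
  assumes "q \<in> Q" and ans: "\<And>J. ans J q = {} \<longleftrightarrow> ans J goal_query = {}"
  shows "\<not> decidable_problem input_code (nullability_inputs ELI_bot AQ Q) nullable"
proof
  assume "decidable_problem input_code (nullability_inputs ELI_bot AQ Q) nullable"
  then obtain f where f: "\<And>x. x \<in> nullability_inputs ELI_bot AQ Q \<Longrightarrow>
      computes f [input_code x] (if nullable x then 1 else 0)"
    unfolding decidable_problem_def by blast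
  define g where "g = diagonal_recf q f"
  define n where "n = list_encode (map inclusion_code (program_ontology (rules_of g) (Fun g)))"
  define x where "x = (input_ontology n (rules_of g) (Fun g), signature, closed_queries, q)"
  let ?h = "Comp is_zero_recf [Comp f [Comp (input_recf q) [Proj 1]]]"
  have "nullable x \<longleftrightarrow> (\<nexists>y. computes g [n] y)"
    unfolding x_def nullable_cong[OF ans] nullable_input_ontology_iff[OF wf_rules_of] ex_computes_iff_ev ..
  moreover have "computes ?h [m, n] (if nullable x then 0 else 1)" for m
  proof -
    have "computes (input_recf q) [n] (input_code x)"
      unfolding x_def n_def by (rule computes_input) simp
    then have "computes (Comp (input_recf q) [Proj 1]) [m, n] (input_code x)"
      by (intro computes_Comp1[of _ _ n] computes_Proj) auto
    moreover have "x \<in> nullability_inputs ELI_bot AQ Q"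
      unfolding x_def using assms(1) by (rule nullability_inputs_input_ontology)
    ultimately have "computes (Comp f [Comp (input_recf q) [Proj 1]]) [m, n] (if nullable x then 1 else 0)"
      using f computes_Comp1 by blast
    from computes_Comp1[OF this] show ?thesis using computes_is_zero by (auto split: if_splits)
  qed
  then have h: "computes ?h [m, n] z \<longleftrightarrow> z = (if nullable x then 0 else 1)" for m z
    using computes_deterministic by blast
  have "(\<exists>y. computes g [n] y) \<longleftrightarrow> nullable x"
  proof
    assume "\<exists>y. computes g [n] y"
    then obtain y where "computes ?h [y, n] 0"
      unfolding g_def diagonal_recf_def by (auto elim: computes_elims(7))
    then show "nullable x" unfolding h by (simp split: if_splits)
  next
    assume "nullable x"
    then have "computes ?h [0, n] 0" unfolding h by simp
    then have "computes g [n] 0" unfolding g_def diagonal_recf_def by (rule computes.Mu) simp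
    then show "\<exists>y. computes g [n] y" ..
  qed
  ultimately show False by blast
qed

theorem theoremA1:
  "\<not> decidable_problem input_code (nullability_inputs ELI_bot AQ IQ) nullable \<and>
   \<not> decidable_problem input_code (nullability_inputs ELI_bot AQ CQ) nullable \<and>
   \<not> decidable_problem input_code (nullability_inputs ELI_bot AQ exists_concept_queries) nullable"
proof (intro conjI)
  have IQ: "goal_query \<in> IQ" by (auto simp: goal_query_def IQ_def)
  then show "\<not> decidable_problem input_code (nullability_inputs ELI_bot AQ IQ) nullable"
    by (rule nullability_undecidable) simp
  show "\<not> decidable_problem input_code (nullability_inputs ELI_bot AQ CQ) nullable"
    using IQ query_classes by (intro nullability_undecidable[of goal_query]) auto
  show "\<not> decidable_problem input_code (nullability_inputs ELI_bot AQ exists_concept_queries) nullable"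
  proof (rule nullability_undecidable)
    show "Query [] [catom Goal 0] \<in> exists_concept_queries"
      by (auto simp: exists_concept_queries_def)
    show "ans J (Query [] [catom Goal 0]) = {} \<longleftrightarrow> ans J goal_query = {}" for J
      by (auto simp: goal_query_def)
  qed
qed

end
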